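(* Let $\ker J$ be dense in $\mathcal H$, let $\mathcal H^J_{\mathrm{har}}\cap\ker J=\{0\}$, and let $L_{\mathrm D}$ be surjective. Then $\check{\mathcal E}=\overline{(\mathcal E_{\mathrm{har}})_{\mathrm{reg}}}$.
   Context: Let $\mathcal H,\mathcal H_{\mathrm{aux}}$ be Hilbert spaces. Let $\mathcal E$ be a closed positive (i.e. symmetric, nonnegative) quadratic form with domain $\mathcal D\subseteq\mathcal H$; write $\mathcal E(\cdot,\cdot)$ for the associated sesquilinear form, $\mathcal E[u]:=\mathcal E(u,u)$, and $\mathcal E_\lambda[u]:=\mathcal E[u]+\lambda\|u\|^2$ for $\lambda>0$. Let $J\colon\operatorname{dom}J\subseteq\mathcal D\to\mathcal H_{\mathrm{aux}}$ be a linear operator with dense range which is closed as an operator from $(\mathcal D,\mathcal E_1^{1/2})$ to $\mathcal H_{\mathrm{aux}}$. For $\lambda>0$ let $P_\lambda$ be the $\mathcal E_\lambda$-orthogonal projection in the Hilbert space $(\mathcal D,\mathcal E_\lambda^{1/2})$ onto the $\mathcal E_\lambda$-orthogonal complement of $\ker J$. Define the closed positive densely defined quadratic form $\check{\mathcal E}_\lambda$ in $\mathcal H_{\mathrm{aux}}$ by $\operatorname{dom}\check{\mathcal E}_\lambda:=\operatorname{ran}J$, $\check{\mathcal E}_\lambda[Ju]:=\mathcal E_\lambda[P_\lambda u]$ for $u\in\operatorname{dom}J$, and let $\check H_\lambda$ be the associated positive self-adjoint operator. Trace form: let $\check{\mathcal E}_0$ be the form with $\operatorname{dom}\check{\mathcal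 E}_0=\operatorname{ran}J$, $\check{\mathcal E}_0[Ju]=\lim_{\lambda\downarrow0}\check{\mathcal E}_\lambda[Ju]$. The trace $\check{\mathcal E}$ of $\mathcal E$ with respect to $J$ is the closed form associated with the positive self-adjoint operator $\check H$ determined by $(\check H_\lambda+1)^{-1}\to(\check H+1)^{-1}$ strongly as $\lambda\downarrow0$; equivalently, $\check{\mathcal E}=\overline{(\check{\mathcal E}_0)_{\mathrm{reg}}}$. Here, for a densely defined positive quadratic form $Q$, the regular part $Q_{\mathrm{reg}}$ is the largest positive densely defined closable quadratic form (with the same domain) dominated by $Q$; a bar denotes the closure. Set $\mathcal H^J_{\mathrm{har}}:=\{u\in\operatorname{dom}J:\ \mathcal E(u,v)=0\text{ for all }v\in\ker J\}$. When $\ker J$ is dense in $\mathcal H$, the form $\mathcal E_{\mathrm D}$ in $\mathcal H$ with $\operatorname{dom}\mathcal E_{\mathrm D}:=\ker J$, $\mathcal E_{\mathrm D}[u]:=\mathcal E[u]$, is densely defined, positive and closed; $L_{\mathrm D}$ denotes the positive self-adjoint operator in $\mathcal H$ associated with $\mathcal E_{\mathrm D}$ ("surjective" means $\operatorname{ran}L_{\mathrm D}=\mathcal H$). Under the hypotheses of the claim, $\operatorname{dom}J=\mathcal H^J_{\mathrm{har}}\oplus\ker J$ (direct sum); let $E_{\mathrm{har}}$ be the projection from $\operatorname{dom}J$ onto $\mathcal H^J_{\mathrm{har}}$ along $\ker J$, and define the form $\mathcal E_{\mathrm{har}}$ in $\mathcal H_{\mathrm{aux}}$ by $\operatorname{dom}\mathcal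 E_{\mathrm{har}}:=\operatorname{ran}J$, $\mathcal E_{\mathrm{har}}[Ju]:=\mathcal E[E_{\mathrm{har}}u]$ for $u\in\operatorname{dom}J$. *)

theory Defs
  imports "HOL-Analysis.Analysis"
begin

section \<open>Complex Hilbert spaces\<close>

text \<open>The scalar product is linear in the first argument. The real Hilbert space structure of the
  library is the one given by its real part, so norm, topology and completeness are the usual ones.\<close>

class chilbert_space = real_inner + complete_space +
  fixes scaleC :: "complex \<Rightarrow> 'a \<Rightarrow> 'a" (infixr "*\<^sub>C" 75)
    and cinner :: "'a \<Rightarrow> 'a \<Rightarrow> complex"
  assumes scaleC_add_right: "a *\<^sub>C (x + y) = a *\<^sub>C x + a *\<^sub>C y"
    and scaleC_add_left: "(a + b) *\<^sub>C x = a *\<^sub>C x + b *\<^sub>C x"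
    and scaleC_scaleC: "a *\<^sub>C b *\<^sub>C x = (a * b) *\<^sub>C x"
    and scaleR_scaleC: "r *\<^sub>R x = complex_of_real r *\<^sub>C x"
    and cinner_commute: "cinner x y = cnj (cinner y x)"
    and cinner_add_left: "cinner (x + y) z = cinner x z + cinner y z"
    and cinner_scaleC_left: "cinner (a *\<^sub>C x) y = a * cinner x y"
    and inner_Re_cinner: "inner x y = Re (cinner x y)"

instantiation complex :: chilbert_space
begin

definition scaleC_complex :: "complex \<Rightarrow> complex \<Rightarrow> complex"
  where "scaleC_complex a x = a * x"

definition cinner_complex :: "complex \<Rightarrow> complex \<Rightarrow> complex"
  where "cinner_complex x y = x * cnj y"

instance
  by standard
    (auto simp: scaleC_complex_def cinner_complex_def algebra_simps inner_complex_def
      scaleR_conv_of_real)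

end

definition csubspace :: "'a::chilbert_space set \<Rightarrow> bool" where
  "csubspace S \<longleftrightarrow> 0 \<in> S \<and> (\<forall>u\<in>S. \<forall>v\<in>S. u + v \<in> S) \<and> (\<forall>c. \<forall>u\<in>S. c *\<^sub>C u \<in> S)"

section \<open>Operators\<close>

text \<open>Unbounded operators and quadratic forms are partial functions, so that \<^term>\<open>dom T\<close> and
  \<^term>\<open>ran T\<close> are their domain and range, \<^term>\<open>S \<subseteq>\<^sub>m T\<close> says that \<^term>\<open>T\<close> extends \<^term>\<open>S\<close>, and
  equality includes equality of domains.\<close>

definition linear_op :: "('a::chilbert_space \<rightharpoonup> 'b::chilbert_space) \<Rightarrow> bool" where
  "linear_op T \<longleftrightarrow> csubspace (dom T) \<and>
     (\<forall>u\<in>dom T. \<forall>v\<in>dom T. the (T (u + v)) = the (T u) + the (T v)) \<and>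
     (\<forall>c. \<forall>u\<in>dom T. the (T (c *\<^sub>C u)) = c *\<^sub>C the (T u))"

definition op_kernel :: "('a::chilbert_space \<rightharpoonup> 'b::chilbert_space) \<Rightarrow> 'a set" where
  "op_kernel T = {u. T u = Some 0}"

definition op_adjoint :: "('a::chilbert_space \<rightharpoonup> 'a) \<Rightarrow> ('a \<rightharpoonup> 'a)" where
  "op_adjoint T u =
     (if \<exists>f. \<forall>v\<in>dom T. cinner (the (T v)) u = cinner v f
      then Some (THE f. \<forall>v\<in>dom T. cinner (the (T v)) u = cinner v f) else None)"

definition positive_selfadjoint :: "('a::chilbert_space \<rightharpoonup> 'a) \<Rightarrow> bool" where
  "positive_selfadjoint T \<longleftrightarrow> linear_op T \<and> closure (dom T) = UNIV \<and> op_adjoint T = T \<and>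
     (\<forall>u\<in>dom T. 0 \<le> Re (cinner (the (T u)) u))"

text \<open>The operator \<open>(T + 1)\<^sup>-\<^sup>1\<close>, which is defined everywhere if \<^term>\<open>T\<close> is positive and
  self-adjoint.\<close>

definition resolvent_one :: "('a::chilbert_space \<rightharpoonup> 'a) \<Rightarrow> 'a \<Rightarrow> 'a" where
  "resolvent_one T f = (THE u. \<exists>g. T u = Some g \<and> g + u = f)"

section \<open>Quadratic forms\<close>

definition sesquilinear_on :: "'a::chilbert_space set \<Rightarrow> ('a \<Rightarrow> 'a \<Rightarrow> complex) \<Rightarrow> bool" where
  "sesquilinear_on S B \<longleftrightarrow>
     (\<forall>u\<in>S. \<forall>v\<in>S. \<forall>w\<in>S. B (u + v) w = B u w + B v w \<and> B w (u + v) = B w u + B w v) \<and>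
     (\<forall>c. \<forall>u\<in>S. \<forall>v\<in>S. B (c *\<^sub>C u) v = c * B u v \<and> B u (c *\<^sub>C v) = cnj c * B u v)"

text \<open>Since the values on the diagonal are real, the sesquilinear form below is automatically
  symmetric on the domain.\<close>

definition positive_form :: "('a::chilbert_space \<rightharpoonup> real) \<Rightarrow> bool" where
  "positive_form Q \<longleftrightarrow> csubspace (dom Q) \<and>
     (\<exists>B. sesquilinear_on (dom Q) B \<and> (\<forall>u\<in>dom Q. B u u = complex_of_real (the (Q u)))) \<and>
     (\<forall>u\<in>dom Q. 0 \<le> the (Q u))"

text \<open>The sesquilinear form associated with a quadratic form, by polarization.\<close>

definition sesq :: "('a::chilbert_space \<rightharpoonup> real) \<Rightarrow> 'a \<Rightarrow> 'a \<Rightarrow> complex" where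
  "sesq Q u v = (\<Sum>k<4. \<i> ^ k * complex_of_real (the (Q (u + \<i> ^ k *\<^sub>C v)))) / 4"

text \<open>Equivalently, the domain is complete for the norm \<open>(Q[u] + \<parallel>u\<parallel>\<^sup>2)\<^sup>1\<^sup>/\<^sup>2\<close>.\<close>

definition closed_form :: "('a::chilbert_space \<rightharpoonup> real) \<Rightarrow> bool" where
  "closed_form Q \<longleftrightarrow> positive_form Q \<and>
     (\<forall>x u. (\<forall>n. x n \<in> dom Q) \<and> x \<longlonglongrightarrow> u \<and>
        (\<forall>e>0. \<exists>N. \<forall>m\<ge>N. \<forall>n\<ge>N. the (Q (x m - x n)) < e) \<longrightarrow>
        u \<in> dom Q \<and> (\<lambda>n. the (Q (x n - u))) \<longlonglongrightarrow> 0)"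

definition closable_form :: "('a::chilbert_space \<rightharpoonup> real) \<Rightarrow> bool" where
  "closable_form Q \<longleftrightarrow> positive_form Q \<and> (\<exists>C. closed_form C \<and> Q \<subseteq>\<^sub>m C)"

definition form_closure :: "('a::chilbert_space \<rightharpoonup> real) \<Rightarrow> ('a \<rightharpoonup> real)" where
  "form_closure Q =
     (THE C. closed_form C \<and> Q \<subseteq>\<^sub>m C \<and> (\<forall>C'. closed_form C' \<and> Q \<subseteq>\<^sub>m C' \<longrightarrow> C \<subseteq>\<^sub>m C'))"

definition closable_minorant ::
    "('a::chilbert_space \<rightharpoonup> real) \<Rightarrow> ('a \<rightharpoonup> real) \<Rightarrow> bool" where
  "closable_minorant Q R \<longleftrightarrow> closable_form R \<and> closure (dom R) = UNIV \<and> dom R = dom Q \<and>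
     (\<forall>u\<in>dom Q. the (R u) \<le> the (Q u))"

definition regular_part :: "('a::chilbert_space \<rightharpoonup> real) \<Rightarrow> ('a \<rightharpoonup> real)" where
  "regular_part Q =
     (THE R. closable_minorant Q R \<and>
        (\<forall>R'. closable_minorant Q R' \<longrightarrow> (\<forall>u\<in>dom Q. the (R' u) \<le> the (R u))))"

text \<open>The positive self-adjoint operator that the first representation theorem associates with a
  densely defined closed form.\<close>

definition form_operator :: "('a::chilbert_space \<rightharpoonup> real) \<Rightarrow> ('a \<rightharpoonup> 'a)" where
  "form_operator Q u =
     (if u \<in> dom Q \<and> (\<exists>f. \<forall>v\<in>dom Q. sesq Q u v = cinner f v)
      then Some (THE f. \<forall>v\<in>dom Q. sesq Q u v = cinner f v) else None)"

definition shift_form :: "real \<Rightarrow> ('a::chilbert_space \<rightharpoonup> real) \<Rightarrow> ('a \<rightharpoonup> real)" where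
  "shift_form l Q u = map_option (\<lambda>r. r + l * (norm u)\<^sup>2) (Q u)"

definition form_orth :: "('a::chilbert_space \<rightharpoonup> real) \<Rightarrow> 'a set \<Rightarrow> 'a set" where
  "form_orth Q S = {u \<in> dom Q. \<forall>v\<in>S. sesq Q u v = 0}"

definition form_proj :: "('a::chilbert_space \<rightharpoonup> real) \<Rightarrow> 'a set \<Rightarrow> 'a \<Rightarrow> 'a" where
  "form_proj Q M u = (THE w. w \<in> M \<and> (\<forall>v\<in>M. sesq Q (u - w) v = 0))"

section \<open>The trace of a form\<close>

definition form_closed_op ::
    "('a::chilbert_space \<rightharpoonup> real) \<Rightarrow> ('a \<rightharpoonup> 'b::chilbert_space) \<Rightarrow> bool" where
  "form_closed_op E J \<longleftrightarrow>
     (\<forall>x u w. (\<forall>n. x n \<in> dom J) \<and> u \<in> dom E \<and>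
        (\<lambda>n. the (shift_form 1 E (x n - u))) \<longlonglongrightarrow> 0 \<and> (\<lambda>n. the (J (x n))) \<longlonglongrightarrow> w \<longrightarrow>
        J u = Some w)"

text \<open>The partial function on the range of \<^term>\<open>J\<close> given by \<open>J u \<mapsto> f u\<close>, for \<^term>\<open>f\<close> such that
  \<open>f u\<close> depends on \<open>J u\<close> only.\<close>

definition form_on_range ::
    "('a::chilbert_space \<rightharpoonup> 'b::chilbert_space) \<Rightarrow> ('a \<Rightarrow> real) \<Rightarrow> ('b \<rightharpoonup> real)" where
  "form_on_range J f w =
     (if w \<in> ran J then Some (THE r. \<forall>u. J u = Some w \<longrightarrow> f u = r) else None)"

definition trace_proj ::
    "('a::chilbert_space \<rightharpoonup> real) \<Rightarrow> ('a \<rightharpoonup> 'b::chilbert_space) \<Rightarrow> real \<Rightarrow> 'a \<Rightarrow> 'a" where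
  "trace_proj E J l = form_proj (shift_form l E) (form_orth (shift_form l E) (op_kernel J))"

definition approx_trace_form ::
    "('a::chilbert_space \<rightharpoonup> real) \<Rightarrow> ('a \<rightharpoonup> 'b::chilbert_space) \<Rightarrow> real \<Rightarrow> ('b \<rightharpoonup> real)" where
  "approx_trace_form E J l =
     form_on_range J (\<lambda>u. the (shift_form l E (trace_proj E J l u)))"

text \<open>The limit of the operators associated with the forms above in the strong resolvent sense.\<close>

definition trace_operator ::
    "('a::chilbert_space \<rightharpoonup> real) \<Rightarrow> ('a \<rightharpoonup> 'b::chilbert_space) \<Rightarrow> ('b \<rightharpoonup> 'b)" where
  "trace_operator E J =
     (THE H. positive_selfadjoint H \<and>
        (\<forall>f. ((\<lambda>l. resolvent_one (form_operator (approx_trace_form E J l)) f)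
              \<longlongrightarrow> resolvent_one H f) (at_right 0)))"

definition trace_form ::
    "('a::chilbert_space \<rightharpoonup> real) \<Rightarrow> ('a \<rightharpoonup> 'b::chilbert_space) \<Rightarrow> ('b \<rightharpoonup> real)" where
  "trace_form E J =
     (THE T. closed_form T \<and> closure (dom T) = UNIV \<and> form_operator T = trace_operator E J)"

section \<open>Harmonic elements\<close>

definition harmonic ::
    "('a::chilbert_space \<rightharpoonup> real) \<Rightarrow> ('a \<rightharpoonup> 'b::chilbert_space) \<Rightarrow> 'a set" where
  "harmonic E J = {u \<in> dom J. \<forall>v\<in>op_kernel J. sesq E u v = 0}"

definition harmonic_proj ::
    "('a::chilbert_space \<rightharpoonup> real) \<Rightarrow> ('a \<rightharpoonup> 'b::chilbert_space) \<Rightarrow> 'a \<Rightarrow> 'a" where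
  "harmonic_proj E J u = (THE h. h \<in> harmonic E J \<and> u - h \<in> op_kernel J)"

definition harmonic_form ::
    "('a::chilbert_space \<rightharpoonup> real) \<Rightarrow> ('a \<rightharpoonup> 'b::chilbert_space) \<Rightarrow> ('b \<rightharpoonup> real)" where
  "harmonic_form E J = form_on_range J (\<lambda>u. the (E (harmonic_proj E J u)))"

definition dirichlet_form ::
    "('a::chilbert_space \<rightharpoonup> real) \<Rightarrow> ('a \<rightharpoonup> 'b::chilbert_space) \<Rightarrow> ('a \<rightharpoonup> real)" where
  "dirichlet_form E J = E |` op_kernel J"

end

theory Submission
  imports Defs
begin

text \<open>Everything rests on one variational principle. For \<open>w = J u\<close> the value \<open>E\<^sub>\<lambda>[P\<^sub>\<lambda> u]\<close> is the minimum of
  \<open>E\<^sub>\<lambda>\<close> over the fibre \<open>u + ker J\<close>, attained at the element \<^emph>\<open>lift\<close> \<open>w\<close> of the fibre that is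
  orthogonal to \<open>ker J\<close>. At \<open>\<lambda> = 0\<close> the element in question is the harmonic one. It exists
  because surjectivity of \<open>L\<^sub>D\<close> forces a spectral gap: solving \<open>L\<^sub>D w = f\<close> bounds
  \<open>\<langle>f, v\<rangle> = E(w, v)\<close> for every \<open>f\<close> on the \<open>E\<close>-unit ball of \<open>ker J\<close>, so that ball is weakly bounded, hence
  norm bounded by the uniform boundedness principle, and \<open>(ker J, E)\<close> is a Hilbert space in which
  the minimisation can be carried out (\<open>dirichlet_gap\<close>, \<open>is_lift_exists\<close>). Comparing the minimisers gives
  \<open>q\<^sub>0[w] \<le> q\<^sub>\<lambda>[w] \<le> q\<^sub>0[w] + \<lambda> \<parallel>h\<parallel>\<^sup>2\<close>,
  where \<open>q\<^sub>\<lambda>\<close> is the approximating trace form, \<open>q\<^sub>0\<close> the harmonic form and \<open>h\<close> the harmonic lift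
  of \<open>w\<close>. Hence \<open>q\<^sub>\<lambda>\<close> converges to the harmonic form from above, pointwise on the range of \<open>J\<close>.

  What remains is a statement about forms: if closed forms with the same domain converge pointwise
  from above to a form \<open>q\<^sub>0\<close>, their resolvents converge to the resolvent of the closure of the regular part of
  \<open>q\<^sub>0\<close>. The limit is identified through the lower semicontinuous \<^emph>\<open>relaxation\<close> \<open>C\<close> of \<open>q\<^sub>0\<close>, the form
  whose epigraph is the closure of the epigraph of \<open>q\<^sub>0\<close>. Closed forms are exactly the positive forms
  with closed epigraph, therefore every closable form below \<open>q\<^sub>0\<close> is below \<open>C\<close>, the restriction of
  \<open>C\<close> is the regular part, and recovery sequences show that the domain of \<open>q\<^sub>0\<close> is a core for \<open>C\<close>
  (\<open>closure_regular_part_eq_relaxation\<close>). The resolvent of a closed form \<open>Q\<close> at \<open>f\<close> minimises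
  \<open>Q[v] + \<parallel>v\<parallel>\<^sup>2 - 2 Re \<langle>f, v\<rangle>\<close>, and this functional exceeds its minimum by at least the squared distance to
  the minimiser. Testing the functional of \<open>q\<^sub>\<lambda>\<close> at a recovery sequence for the minimiser of the functional of
  \<open>C\<close> squeezes the minimisers together (\<open>resolvent_convergence_from_above\<close>).

  The limit operator and its form are determined uniquely: a positive self-adjoint operator is
  determined by its resolvent, and a closed form by its operator, because \<open>n (H + n)\<^sup>-\<^sup>1 u\<close>
  approximates \<open>u\<close> without increasing the energy (\<open>trace_form_eqI\<close>).\<close>

section \<open>Algebra of complex Hilbert spaces\<close>

lemma scaleC_one: "1 *\<^sub>C x = (x::'a::chilbert_space)"
  using scaleR_scaleC[of 1 x] by simp

lemma scaleC_zero: "0 *\<^sub>C x = (0::'a::chilbert_space)"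
  using scaleR_scaleC[of 0 x] by simp

lemma scaleC_minus_one: "(-1) *\<^sub>C x = - (x::'a::chilbert_space)"
  using scaleR_scaleC[of "-1" x] by simp

lemma scaleC_zero_right: "c *\<^sub>C (0::'a::chilbert_space) = 0"
  using scaleC_add_right[of c 0 "0::'a"] by simp

lemma scaleC_minus_right: "c *\<^sub>C (- x) = - (c *\<^sub>C (x::'a::chilbert_space))"
  using scaleC_add_right[of c x "-x"] by (simp add: scaleC_zero_right eq_neg_iff_add_eq_0 add.commute)

lemma scaleC_diff_right: "c *\<^sub>C (x - y) = c *\<^sub>C x - c *\<^sub>C (y::'a::chilbert_space)"
  using scaleC_add_right[of c x "-y"] by (simp add: scaleC_minus_right)

lemma cinner_add_right: "cinner x (y + z) = cinner x y + cinner x (z::'a::chilbert_space)"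
  by (metis cinner_add_left cinner_commute complex_cnj_add)

lemma cinner_scaleC_right: "cinner x (c *\<^sub>C y) = cnj c * cinner x (y::'a::chilbert_space)"
  by (metis cinner_scaleC_left cinner_commute complex_cnj_mult)

lemma cinner_diff_left: "cinner (x - y) z = cinner x z - cinner y (z::'a::chilbert_space)"
  by (metis cinner_add_left add_diff_cancel_right' diff_add_cancel)

lemma cinner_diff_right: "cinner x (y - z) = cinner x y - cinner x (z::'a::chilbert_space)"
  by (metis cinner_add_right add_diff_cancel_right' diff_add_cancel)

lemma cinner_self: "cinner x x = of_real ((norm (x::'a::chilbert_space))\<^sup>2)"
proof -
  have "Im (cinner x x) = 0"
    using arg_cong[OF cinner_commute[of x x], of Im] by simp
  then show ?thesis
    by (simp add: complex_eq_iff power2_norm_eq_inner inner_Re_cinner)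
qed

lemma norm_scaleC: "norm (c *\<^sub>C x) = cmod c * norm (x::'a::chilbert_space)"
proof -
  have "complex_of_real ((norm (c *\<^sub>C x))\<^sup>2) = c * cnj c * of_real ((norm x)\<^sup>2)"
    by (simp only: cinner_self[symmetric] cinner_scaleC_left cinner_scaleC_right mult_ac)
  also have "\<dots> = of_real ((cmod c * norm x)\<^sup>2)"
    by (simp only: complex_norm_square[symmetric] of_real_mult power_mult_distrib)
  finally show ?thesis
    by (simp only: of_real_eq_iff) (simp add: power2_eq_iff_nonneg)
qed

lemma continuous_scaleC:
  assumes "x \<longlonglongrightarrow> (u::'a::chilbert_space)" shows "(\<lambda>n. c *\<^sub>C x n) \<longlonglongrightarrow> c *\<^sub>C u"
proof -
  have "(\<lambda>n. cmod c * norm (x n - u)) \<longlonglongrightarrow> cmod c * 0"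
    using assms by (intro tendsto_intros) (simp add: tendsto_norm_zero LIM_zero_iff)
  then have "(\<lambda>n. norm (c *\<^sub>C x n - c *\<^sub>C u)) \<longlonglongrightarrow> 0"
    by (simp add: norm_scaleC flip: scaleC_diff_right)
  from LIM_zero_cancel[OF tendsto_norm_zero_cancel[OF this]] show ?thesis .
qed

lemma orthogonal_to_dense:
  assumes "closure S = UNIV" and "\<forall>v\<in>S. cinner f v = 0"
  shows "f = (0::'a::chilbert_space)"
proof -
  have "closed {v. inner f v = 0}"
    by (intro closed_Collect_eq continuous_intros)
  moreover have "S \<subseteq> {v. inner f v = 0}"
    using assms(2) by (auto simp: inner_Re_cinner)
  ultimately have "closure S \<subseteq> {v. inner f v = 0}"
    by (rule closure_minimal[rotated])
  then have "inner f f = 0" using assms(1) by blast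
  then show ?thesis by simp
qed

lemma cinner_eq_on_dense:
  assumes "closure S = UNIV" and "\<forall>v\<in>S. cinner f v = cinner g v"
  shows "f = (g::'a::chilbert_space)"
  using orthogonal_to_dense[OF assms(1), of "f - g"] assms(2) by (simp add: cinner_diff_left)

lemma csubspace_zero: "csubspace S \<Longrightarrow> 0 \<in> S"
  and csubspace_add: "csubspace S \<Longrightarrow> u \<in> S \<Longrightarrow> v \<in> S \<Longrightarrow> u + v \<in> S"
  and csubspace_scaleC: "csubspace S \<Longrightarrow> u \<in> S \<Longrightarrow> c *\<^sub>C u \<in> S"
  by (auto simp: csubspace_def)

lemma csubspace_scaleR: "csubspace S \<Longrightarrow> u \<in> S \<Longrightarrow> r *\<^sub>R u \<in> S"
  by (simp add: scaleR_scaleC csubspace_scaleC)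

lemma csubspace_minus: "csubspace S \<Longrightarrow> u \<in> S \<Longrightarrow> - u \<in> S"
  using csubspace_scaleC[of S u "-1"] by (simp add: scaleC_minus_one)

lemma csubspace_diff: "csubspace S \<Longrightarrow> u \<in> S \<Longrightarrow> v \<in> S \<Longrightarrow> u - v \<in> S"
  using csubspace_add[of S u "- v"] by (simp add: csubspace_minus)

section \<open>Positive quadratic forms\<close>

text \<open>Polarization: the fourth roots of unity sum to zero, as do their squares, so only the term
  \<open>B u v\<close> survives.\<close>

lemma sesq_eq_sesquilinear:
  assumes S: "csubspace (dom Q)" and B: "sesquilinear_on (dom Q) B"
    and BQ: "\<forall>u\<in>dom Q. B u u = complex_of_real (the (Q u))"
    and u: "u \<in> dom Q" and v: "v \<in> dom Q"
  shows "sesq Q u v = B u v"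
proof -
  have val: "complex_of_real (the (Q (u + c *\<^sub>C v)))
      = B u u + cnj c * B u v + c * B v u + c * cnj c * B v v" for c
  proof -
    have cv: "c *\<^sub>C v \<in> dom Q" and s: "u + c *\<^sub>C v \<in> dom Q"
      using u v by (simp_all add: csubspace_add[OF S] csubspace_scaleC[OF S])
    have "complex_of_real (the (Q (u + c *\<^sub>C v))) = B (u + c *\<^sub>C v) (u + c *\<^sub>C v)"
      using BQ s by simp
    also have "\<dots> = B u u + B u (c *\<^sub>C v) + (B (c *\<^sub>C v) u + B (c *\<^sub>C v) (c *\<^sub>C v))"
      using B u cv s unfolding sesquilinear_on_def by simp
    also have "\<dots> = B u u + cnj c * B u v + c * B v u + c * cnj c * B v v"
      using B u v cv unfolding sesquilinear_on_def by (simp add: algebra_simps)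
    finally show ?thesis .
  qed
  have "{..<4} = {0, 1, 2, 3::nat}" by auto
  then have "sesq Q u v = ((B u u + B u v + B v u + B v v)
      + \<i> * (B u u - \<i> * B u v + \<i> * B v u + B v v)
      - (B u u - B u v - B v u + B v v)
      - \<i> * (B u u + \<i> * B u v - \<i> * B v u + B v v)) / 4"
    unfolding sesq_def val by (simp add: eval_nat_numeral)
  also have "\<dots> = B u v"
    by (simp add: complex_eq_iff)
  finally show ?thesis .
qed

lemma positive_formI:
  assumes "csubspace (dom Q)" "sesquilinear_on (dom Q) B"
    "\<And>u. u \<in> dom Q \<Longrightarrow> B u u = complex_of_real (the (Q u))"
    "\<And>u. u \<in> dom Q \<Longrightarrow> 0 \<le> the (Q u)"
  shows "positive_form Q"
  using assms unfolding positive_form_def by blast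

context
  fixes Q :: "'a::chilbert_space \<rightharpoonup> real"
  assumes pf: "positive_form Q"
begin

lemma form_csubspace: "csubspace (dom Q)"
  using pf by (simp add: positive_form_def)

lemma form_nonneg: "u \<in> dom Q \<Longrightarrow> 0 \<le> the (Q u)"
  using pf by (simp add: positive_form_def)

lemma form_sesquilinear: "sesquilinear_on (dom Q) (sesq Q)"
  and sesq_self: "u \<in> dom Q \<Longrightarrow> sesq Q u u = complex_of_real (the (Q u))"
proof -
  obtain B where B: "sesquilinear_on (dom Q) B"
      "\<forall>u\<in>dom Q. B u u = complex_of_real (the (Q u))"
    using pf by (auto simp: positive_form_def)
  have eq: "sesq Q u v = B u v" if "u \<in> dom Q" "v \<in> dom Q" for u v
    using sesq_eq_sesquilinear[OF form_csubspace B that] .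
  show "sesquilinear_on (dom Q) (sesq Q)"
    using B(1) form_csubspace unfolding sesquilinear_on_def
    by (simp add: eq csubspace_add csubspace_scaleC)
  show "sesq Q u u = complex_of_real (the (Q u))" if "u \<in> dom Q"
    using that by (simp add: eq B(2))
qed

lemma sesq_add_left:
    "\<lbrakk>u \<in> dom Q; v \<in> dom Q; w \<in> dom Q\<rbrakk> \<Longrightarrow> sesq Q (u + v) w = sesq Q u w + sesq Q v w"
  and sesq_add_right:
    "\<lbrakk>u \<in> dom Q; v \<in> dom Q; w \<in> dom Q\<rbrakk> \<Longrightarrow> sesq Q w (u + v) = sesq Q w u + sesq Q w v"
  and sesq_scaleC_left: "\<lbrakk>u \<in> dom Q; v \<in> dom Q\<rbrakk> \<Longrightarrow> sesq Q (c *\<^sub>C u) v = c * sesq Q u v"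
  and sesq_scaleC_right: "\<lbrakk>u \<in> dom Q; v \<in> dom Q\<rbrakk> \<Longrightarrow> sesq Q u (c *\<^sub>C v) = cnj c * sesq Q u v"
  using form_sesquilinear unfolding sesquilinear_on_def by blast+

lemma sesq_diff_left:
  assumes "u \<in> dom Q" "v \<in> dom Q" "w \<in> dom Q"
  shows "sesq Q (u - v) w = sesq Q u w - sesq Q v w"
  using sesq_add_left[of "u - v" v w] assms csubspace_diff[OF form_csubspace] by simp

lemma form_scaleC:
  assumes "u \<in> dom Q" shows "the (Q (c *\<^sub>C u)) = (cmod c)\<^sup>2 * the (Q u)"
proof -
  have cu: "c *\<^sub>C u \<in> dom Q"
    using assms by (simp add: csubspace_scaleC form_csubspace)
  have "complex_of_real (the (Q (c *\<^sub>C u))) = c * cnj c * of_real (the (Q u))"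
    using sesq_self[OF cu] sesq_self[OF assms] assms cu
    by (simp add: sesq_scaleC_left sesq_scaleC_right mult_ac)
  also have "\<dots> = of_real ((cmod c)\<^sup>2 * the (Q u))"
    by (simp only: complex_norm_square of_real_mult)
  finally show ?thesis by (simp only: of_real_eq_iff)
qed

lemma form_scaleR: "u \<in> dom Q \<Longrightarrow> the (Q (r *\<^sub>R u)) = r\<^sup>2 * the (Q u)"
  by (simp add: scaleR_scaleC form_scaleC)

lemma form_zero: "the (Q 0) = 0"
  using form_scaleR[of 0 0] csubspace_zero[OF form_csubspace] by simp

lemma form_minus_commute:
  "u \<in> dom Q \<Longrightarrow> v \<in> dom Q \<Longrightarrow> the (Q (u - v)) = the (Q (v - u))"
  using form_scaleR[of "v - u" "-1"] by (simp add: csubspace_diff form_csubspace)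

text \<open>Reality of the diagonal at \<open>u + v\<close> and at \<open>u + \<i> v\<close> yields the imaginary and the real part of
  the symmetry.\<close>

lemma sesq_commute:
  assumes u: "u \<in> dom Q" and v: "v \<in> dom Q"
  shows "sesq Q v u = cnj (sesq Q u v)"
proof -
  have uv: "u + v \<in> dom Q" and iv: "\<i> *\<^sub>C v \<in> dom Q" and uiv: "u + \<i> *\<^sub>C v \<in> dom Q"
    using u v by (simp_all add: csubspace_add csubspace_scaleC form_csubspace)
  have "sesq Q (u + v) (u + v) = sesq Q u u + sesq Q u v + sesq Q v u + sesq Q v v"
    using u v uv by (simp add: sesq_add_left sesq_add_right)
  then have 1: "Im (sesq Q u v + sesq Q v u) = 0"
    using sesq_self[OF u] sesq_self[OF v] sesq_self[OF uv]
    by (metis Im_complex_of_real add.commute add.left_neutral plus_complex.sel(2))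
  have "sesq Q (u + \<i> *\<^sub>C v) (u + \<i> *\<^sub>C v)
      = sesq Q u u - \<i> * sesq Q u v + \<i> * sesq Q v u + sesq Q v v"
    using u v iv uiv
    by (simp add: sesq_add_left sesq_add_right sesq_scaleC_left sesq_scaleC_right complex_eq_iff)
  then have "Im (\<i> * sesq Q v u - \<i> * sesq Q u v) = 0"
    using sesq_self[OF u] sesq_self[OF v] sesq_self[OF uiv]
    by (simp add: complex_eq_iff)
  with 1 show ?thesis by (simp add: complex_eq_iff)
qed

lemma form_add:
  assumes u: "u \<in> dom Q" and v: "v \<in> dom Q"
  shows "the (Q (u + v)) = the (Q u) + the (Q v) + 2 * Re (sesq Q u v)"
proof -
  have uv: "u + v \<in> dom Q" using u v by (simp add: csubspace_add form_csubspace)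
  have "sesq Q (u + v) (u + v) = sesq Q u u + sesq Q u v + sesq Q v u + sesq Q v v"
    using u v uv by (simp add: sesq_add_left sesq_add_right)
  from arg_cong[OF this, of Re] show ?thesis
    using sesq_self[OF u] sesq_self[OF v] sesq_self[OF uv] sesq_commute[OF u v] by simp
qed

lemma form_add_scaleR:
  assumes u: "u \<in> dom Q" and v: "v \<in> dom Q"
  shows "the (Q (u + t *\<^sub>R v)) = the (Q u) + t\<^sup>2 * the (Q v) + 2 * t * Re (sesq Q u v)"
proof -
  have tv: "t *\<^sub>R v \<in> dom Q" using v by (simp add: csubspace_scaleR form_csubspace)
  have "sesq Q u (t *\<^sub>R v) = t * sesq Q u v"
    using u v by (simp add: scaleR_scaleC sesq_scaleC_right)
  then show ?thesis using form_add[OF u tv] v by (simp add: form_scaleR)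
qed

lemma form_diff:
  assumes "u \<in> dom Q" "v \<in> dom Q"
  shows "the (Q (u - v)) = the (Q u) + the (Q v) - 2 * Re (sesq Q u v)"
  using form_add_scaleR[OF assms, of "-1"] by simp

lemma form_parallelogram:
  assumes "u \<in> dom Q" "v \<in> dom Q"
  shows "the (Q (u + v)) + the (Q (u - v)) = 2 * the (Q u) + 2 * the (Q v)"
  using form_add[OF assms] form_diff[OF assms] by simp

text \<open>The form of the parallelogram law in which uniform convexity is used throughout: two
  near-minimisers in a convex set have a midpoint that is no better, so they are close.\<close>

lemma form_midpoint:
  assumes u: "u \<in> dom Q" and v: "v \<in> dom Q"
  shows "the (Q ((1/2) *\<^sub>R (u + v))) = (the (Q u) + the (Q v)) / 2 - the (Q (u - v)) / 4"
proof -
  have "u + v \<in> dom Q" using assms by (simp add: csubspace_add form_csubspace)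
  from form_scaleR[OF this, of "1/2"] form_parallelogram[OF assms]
  show ?thesis by (simp add: power2_eq_square field_simps)
qed

lemma form_add_le:
  assumes "u \<in> dom Q" "v \<in> dom Q"
  shows "the (Q (u + v)) \<le> 2 * the (Q u) + 2 * the (Q v)"
  using form_parallelogram[OF assms] form_nonneg[of "u - v"] assms
  by (simp add: csubspace_diff form_csubspace)

end

text \<open>The discriminant condition for a polynomial without negative values, including the degenerate
  case \<open>a = 0\<close>, which occurs because forms need not be definite.\<close>

lemma slope_bound:
  fixes a b e :: real
  assumes nonneg: "\<And>t. 0 \<le> e + 2 * t * b + t\<^sup>2 * a" and a: "0 \<le> a"
  shows "b\<^sup>2 \<le> e * a"
proof (cases "a = 0")
  case True
  have "b = 0"
  proof (rule ccontr)
    assume "b \<noteq> 0"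
    then show False
      using nonneg[of "-(e + 1) / (2 * b)"] True by (simp add: field_simps)
  qed
  then show ?thesis using True by simp
next
  case False
  then have "0 < a" using a by simp
  then show ?thesis
    using nonneg[of "- b / a"] by (simp add: field_simps power2_eq_square)
qed

context
  fixes Q :: "'a::chilbert_space \<rightharpoonup> real"
  assumes pf: "positive_form Q"
begin

text \<open>Multiplying \<open>u\<close> by a phase makes \<open>sesq Q u v\<close> real and nonnegative; positivity along the real line
  through \<open>u\<close> in direction \<open>v\<close> then bounds it.\<close>

lemma form_Cauchy_Schwarz:
  assumes u: "u \<in> dom Q" and v: "v \<in> dom Q"
  shows "(cmod (sesq Q u v))\<^sup>2 \<le> the (Q u) * the (Q v)"
proof (cases "sesq Q u v = 0")
  case True
  then show ?thesis using form_nonneg[OF pf] u v by simp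
next
  case False
  define c where "c = cnj (sesq Q u v) / cmod (sesq Q u v)"
  have c: "cmod c = 1" and cB: "c * sesq Q u v = cmod (sesq Q u v)"
    using False by (simp_all add: c_def norm_divide complex_norm_square[symmetric]
        mult.commute[of "cnj _"] power2_eq_square)
  have cu: "c *\<^sub>C u \<in> dom Q" using u by (simp add: csubspace_scaleC form_csubspace pf)
  have "(Re (sesq Q (c *\<^sub>C u) v))\<^sup>2 \<le> the (Q (c *\<^sub>C u)) * the (Q v)"
  proof (rule slope_bound)
    fix t
    have "c *\<^sub>C u + t *\<^sub>R v \<in> dom Q"
      using cu v by (simp add: csubspace_add csubspace_scaleR form_csubspace pf)
    from form_nonneg[OF pf this]
    show "0 \<le> the (Q (c *\<^sub>C u)) + 2 * t * Re (sesq Q (c *\<^sub>C u) v) + t\<^sup>2 * the (Q v)"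
      using form_add_scaleR[OF pf cu v, of t] by simp
  qed (simp add: form_nonneg pf v)
  then show ?thesis
    using u v by (simp add: sesq_scaleC_left pf cB form_scaleC c)
qed

lemma sesq_tendsto_left:
  assumes x: "\<And>n. x n \<in> dom Q" and u: "u \<in> dom Q" and v: "v \<in> dom Q"
    and lim: "(\<lambda>n. the (Q (x n - u))) \<longlonglongrightarrow> 0"
  shows "(\<lambda>n. sesq Q (x n) v) \<longlonglongrightarrow> sesq Q u v"
proof -
  have d: "x n - u \<in> dom Q" for n using x u by (simp add: csubspace_diff form_csubspace pf)
  let ?b = "\<lambda>n. sqrt (the (Q (x n - u)) * the (Q v))"
  have "?b \<longlonglongrightarrow> sqrt (0 * the (Q v))"
    by (intro tendsto_intros lim)
  then have b: "?b \<longlonglongrightarrow> 0" by simp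
  have le: "norm (sesq Q (x n) v - sesq Q u v) \<le> ?b n" for n
  proof -
    have "(cmod (sesq Q (x n) v - sesq Q u v))\<^sup>2 \<le> the (Q (x n - u)) * the (Q v)"
      using form_Cauchy_Schwarz[OF d v, of n] sesq_diff_left[OF pf x u v] by simp
    then show ?thesis by (rule real_le_rsqrt)
  qed
  have "(\<lambda>n. sesq Q (x n) v - sesq Q u v) \<longlonglongrightarrow> 0"
    by (rule Lim_null_comparison[OF always_eventually[OF allI[OF le]] b])
  then show ?thesis by (rule LIM_zero_cancel)
qed

lemma form_tendsto:
  assumes x: "\<And>n. x n \<in> dom Q" and u: "u \<in> dom Q"
    and lim: "(\<lambda>n. the (Q (x n - u))) \<longlonglongrightarrow> 0"
  shows "(\<lambda>n. the (Q (x n))) \<longlonglongrightarrow> the (Q u)"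
proof -
  have "(\<lambda>n. the (Q (x n - u)) + 2 * Re (sesq Q (x n) u) - the (Q u))
      \<longlonglongrightarrow> 0 + 2 * Re (sesq Q u u) - the (Q u)"
    by (rule tendsto_diff tendsto_add tendsto_mult tendsto_const tendsto_Re lim
        sesq_tendsto_left[OF x u u lim])+
  moreover have "the (Q (x n - u)) + 2 * Re (sesq Q (x n) u) - the (Q u) = the (Q (x n))" for n
    using form_diff[OF pf x u, of n] by simp
  ultimately show ?thesis using sesq_self[OF pf u] by simp
qed

end

section \<open>Minimisation in complete forms\<close>

definition form_Cauchy :: "('a::chilbert_space \<rightharpoonup> real) \<Rightarrow> (nat \<Rightarrow> 'a) \<Rightarrow> bool" where
  "form_Cauchy Q x \<longleftrightarrow> (\<forall>e>0. \<exists>N. \<forall>m\<ge>N. \<forall>n\<ge>N. the (Q (x m - x n)) < e)"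

definition form_complete_on :: "('a::chilbert_space \<rightharpoonup> real) \<Rightarrow> 'a set \<Rightarrow> bool" where
  "form_complete_on Q S \<longleftrightarrow>
     (\<forall>x. (\<forall>n. x n \<in> S) \<and> form_Cauchy Q x \<longrightarrow> (\<exists>u\<in>S. (\<lambda>n. the (Q (x n - u))) \<longlonglongrightarrow> 0))"

lemma form_CauchyI:
  assumes pf: "positive_form Q" and x: "\<And>n. x n \<in> dom Q"
    and r: "r \<longlonglongrightarrow> 0" and le: "\<And>i j. i \<le> j \<Longrightarrow> the (Q (x i - x j)) \<le> r i"
  shows "form_Cauchy Q x"
  unfolding form_Cauchy_def
proof (intro allI impI)
  fix e :: real assume "0 < e"
  then obtain N where N: "\<And>i. i \<ge> N \<Longrightarrow> r i < e"
    using order_tendstoD(2)[OF r] unfolding eventually_sequentially by blast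
  have "the (Q (x m - x n)) < e" if "m \<ge> N" "n \<ge> N" for m n
  proof (cases "m \<le> n")
    case True
    then show ?thesis using le[of m n] N[of m] that by simp
  next
    case False
    then show ?thesis
      using le[of n m] N[of n] that form_minus_commute[OF pf x x, of m n] by simp
  qed
  then show "\<exists>N. \<forall>m\<ge>N. \<forall>n\<ge>N. the (Q (x m - x n)) < e" by blast
qed

lemma form_Cauchy_mono:
  assumes "form_Cauchy Q x" and "\<And>m n. the (R (y m - y n)) \<le> the (Q (x m - x n))"
  shows "form_Cauchy R y"
  using assms unfolding form_Cauchy_def by (meson le_less_trans)

lemma closed_formD:
  assumes "closed_form Q" "\<And>n. x n \<in> dom Q" "x \<longlonglongrightarrow> u" "form_Cauchy Q x"
  shows "u \<in> dom Q" "(\<lambda>n. the (Q (x n - u))) \<longlonglongrightarrow> 0"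
  using assms unfolding closed_form_def form_Cauchy_def by blast+

lemma closed_form_positive: "closed_form Q \<Longrightarrow> positive_form Q"
  by (simp add: closed_form_def)

lemma inverse_Suc_tendsto_zero: "(\<lambda>n. c / real (Suc n)) \<longlonglongrightarrow> 0"
  using tendsto_mult[OF tendsto_const[of c] LIMSEQ_inverse_real_of_nat]
  by (simp add: divide_inverse)

text \<open>The Riesz representation and projection theorems in one: a functional \<open>Q[v] - 2 Re (l v)\<close> that is bounded
  below on a subspace complete for \<open>Q\<close> has a critical point. The lower bound replaces the continuity of
  \<open>l\<close> with respect to the form: a minimising sequence is Cauchy by the parallelogram law, and its
  members already satisfy the Euler equation up to an error controlled by their defect.\<close>

lemma form_variational:
  fixes Q :: "'a::chilbert_space \<rightharpoonup> real" and l :: "'a \<Rightarrow> complex"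
  assumes pf: "positive_form Q" and S: "csubspace S" and sub: "S \<subseteq> dom Q"
    and complete: "form_complete_on Q S"
    and l_add: "\<And>u v. u \<in> S \<Longrightarrow> v \<in> S \<Longrightarrow> l (u + v) = l u + l v"
    and l_scaleC: "\<And>c u. u \<in> S \<Longrightarrow> l (c *\<^sub>C u) = cnj c * l u"
    and bounded: "\<And>v. v \<in> S \<Longrightarrow> M \<le> the (Q v) - 2 * Re (l v)"
  shows "\<exists>v\<in>S. \<forall>w\<in>S. sesq Q v w = l w"
proof -
  define F where "F v = the (Q v) - 2 * Re (l v)" for v
  define m where "m = Inf (F ` S)"
  have ne: "S \<noteq> {}" using csubspace_zero[OF S] by blast
  have bdd: "bdd_below (F ` S)" by (rule bdd_belowI2[of _ M]) (simp add: F_def bounded)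
  have m_le: "m \<le> F v" if "v \<in> S" for v
    unfolding m_def using bdd that by (rule cINF_lower)
  have "\<exists>v\<in>S. F v < m + 1 / real (Suc n)" for n
    using cInf_lessD[of "F ` S" "m + 1 / real (Suc n)"] ne by (auto simp: m_def)
  then obtain x where xS: "\<And>n. x n \<in> S" and xF: "\<And>n. F (x n) < m + 1 / real (Suc n)"
    by metis
  have xQ: "x n \<in> dom Q" for n using xS sub by blast
  have l_scaleR: "l (t *\<^sub>R u) = t * l u" if "u \<in> S" for t u
    using l_scaleC[OF that] by (simp add: scaleR_scaleC)
  \<comment> \<open>Perturbing a near-minimiser in direction \<open>t w\<close> cannot gain more than its defect.\<close>
  have near: "(Re (sesq Q (x n) w - l w))\<^sup>2 \<le> 1 / real (Suc n) * the (Q w)" if w: "w \<in> S" for n w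
  proof (rule slope_bound)
    have wQ: "w \<in> dom Q" using w sub by blast
    show "0 \<le> the (Q w)" using form_nonneg[OF pf wQ] .
    fix t
    have tw: "t *\<^sub>R w \<in> S" using csubspace_scaleR[OF S w] .
    have "F (x n + t *\<^sub>R w) = F (x n) + 2 * t * Re (sesq Q (x n) w - l w) + t\<^sup>2 * the (Q w)"
      unfolding F_def form_add_scaleR[OF pf xQ wQ] l_add[OF xS tw] l_scaleR[OF w]
      by (simp add: algebra_simps)
    then show "0 \<le> 1 / real (Suc n) + 2 * t * Re (sesq Q (x n) w - l w) + t\<^sup>2 * the (Q w)"
      using m_le[OF csubspace_add[OF S xS tw], of n] xF[of n] by simp
  qed
  have "form_Cauchy Q x"
  proof (rule form_CauchyI[OF pf xQ inverse_Suc_tendsto_zero[of 4]])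
    fix i j :: nat assume "i \<le> j"
    then have ij: "1 / real (Suc j) \<le> 1 / real (Suc i)" by (simp add: frac_le)
    have s: "x i + x j \<in> S" using csubspace_add[OF S xS xS] .
    have "F ((1/2) *\<^sub>R (x i + x j)) = (F (x i) + F (x j)) / 2 - the (Q (x i - x j)) / 4"
      unfolding F_def form_midpoint[OF pf xQ xQ] l_scaleR[OF s] l_add[OF xS xS]
      by (simp add: field_simps)
    then have "the (Q (x i - x j)) \<le> 4 * (1 / real (Suc i))"
      using m_le[OF csubspace_scaleR[OF S s], of "1/2"] xF[of i] xF[of j] ij
      by (simp only: of_nat_Suc) argo
    then show "the (Q (x i - x j)) \<le> 4 / real (Suc i)" by simp
  qed
  then obtain v where v: "v \<in> S" and lim: "(\<lambda>n. the (Q (x n - v))) \<longlonglongrightarrow> 0"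
    using complete xS unfolding form_complete_on_def by blast
  have vQ: "v \<in> dom Q" using v sub by blast
  have Re0: "Re (sesq Q v w - l w) = 0" if w: "w \<in> S" for w
  proof -
    have wQ: "w \<in> dom Q" using w sub by blast
    have 1: "(\<lambda>n. (Re (sesq Q (x n) w - l w))\<^sup>2) \<longlonglongrightarrow> (Re (sesq Q v w - l w))\<^sup>2"
      by (intro tendsto_power tendsto_Re tendsto_diff tendsto_const sesq_tendsto_left[OF pf xQ vQ wQ lim])
    have "(\<lambda>n. 1 / real (Suc n) * the (Q w)) \<longlonglongrightarrow> 0 * the (Q w)"
      by (intro tendsto_mult tendsto_const inverse_Suc_tendsto_zero)
    then have 2: "(\<lambda>n. 1 / real (Suc n) * the (Q w)) \<longlonglongrightarrow> 0" by simp
    have "(Re (sesq Q v w - l w))\<^sup>2 \<le> 0"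
      by (rule LIMSEQ_le[OF 1 2]) (use near[OF w] in blast)
    then show ?thesis by simp
  qed
  have "sesq Q v w = l w" if w: "w \<in> S" for w
  proof -
    \<comment> \<open>The real part of the equation at \<open>\<i> w\<close> is the imaginary part of the equation at \<open>w\<close>.\<close>
    have iw: "\<i> *\<^sub>C w \<in> S" and wQ: "w \<in> dom Q" using csubspace_scaleC[OF S w] w sub by auto
    have "sesq Q v (\<i> *\<^sub>C w) - l (\<i> *\<^sub>C w) = - \<i> * (sesq Q v w - l w)"
      by (simp add: sesq_scaleC_right[OF pf vQ wQ] l_scaleC[OF w] algebra_simps)
    then have "Im (sesq Q v w - l w) = 0" using Re0[OF iw] by simp
    with Re0[OF w] show ?thesis by (simp add: complex_eq_iff)
  qed
  with v show ?thesis by blast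
qed

lemma dom_shift_form [simp]: "dom (shift_form l Q) = dom Q"
  by (auto simp: shift_form_def)

lemma the_shift_form: "u \<in> dom Q \<Longrightarrow> the (shift_form l Q u) = the (Q u) + l * (norm u)\<^sup>2"
  by (auto simp: shift_form_def)

lemma shift_form_zero: "shift_form 0 Q = Q"
  by (rule ext) (simp add: shift_form_def option.map_ident)

lemma shift_form_positive:
  assumes pf: "positive_form Q" and l: "0 \<le> l"
  shows "positive_form (shift_form l Q)"
    and sesq_shift_form: "u \<in> dom Q \<Longrightarrow> v \<in> dom Q \<Longrightarrow>
      sesq (shift_form l Q) u v = sesq Q u v + complex_of_real l * cinner u v"
proof -
  let ?B = "\<lambda>u v. sesq Q u v + complex_of_real l * cinner u v"
  have B: "sesquilinear_on (dom Q) ?B"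
    unfolding sesquilinear_on_def
    by (simp add: sesq_add_left[OF pf] sesq_add_right[OF pf] sesq_scaleC_left[OF pf]
        sesq_scaleC_right[OF pf] cinner_add_left cinner_add_right cinner_scaleC_left
        cinner_scaleC_right algebra_simps)
  have BQ: "?B u u = complex_of_real (the (shift_form l Q u))" if "u \<in> dom Q" for u
    using that by (simp add: sesq_self[OF pf] the_shift_form cinner_self)
  show "positive_form (shift_form l Q)"
    by (rule positive_formI[of _ ?B])
      (simp_all add: form_csubspace[OF pf] B BQ the_shift_form form_nonneg[OF pf] l)
  show "sesq (shift_form l Q) u v = ?B u v" if "u \<in> dom Q" "v \<in> dom Q"
    by (rule sesq_eq_sesquilinear) (simp_all add: form_csubspace[OF pf] B BQ that)
qed

text \<open>The source of all completeness used below. Coercivity turns \<open>E\<^sub>l\<close>-Cauchy sequences into norm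
  convergent ones, to which closedness of the form applies. The case \<open>l = 0\<close> with a spectral gap
  and the case \<open>l > 0\<close> without one are both needed.\<close>

lemma closed_form_complete_on:
  assumes cf: "closed_form Q" and l: "0 \<le> l" and c: "0 < c"
    and S: "csubspace S" and sub: "S \<subseteq> dom Q"
    and coercive: "\<And>v. v \<in> S \<Longrightarrow> c * (norm v)\<^sup>2 \<le> the (shift_form l Q v)"
    and S_closed: "\<And>x u. \<lbrakk>\<And>n. x n \<in> S; x \<longlonglongrightarrow> u; u \<in> dom Q; (\<lambda>n. the (Q (x n - u))) \<longlonglongrightarrow> 0\<rbrakk>
      \<Longrightarrow> u \<in> S"
  shows "form_complete_on (shift_form l Q) S"
  unfolding form_complete_on_def
proof (intro allI impI, elim conjE)
  fix x assume xS: "\<forall>n. x n \<in> S" and Cx: "form_Cauchy (shift_form l Q) x"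
  note pf = closed_form_positive[OF cf]
  have xQ: "x n \<in> dom Q" for n using xS sub by blast
  have dS: "x m - x n \<in> S" for m n using csubspace_diff[OF S] xS by blast
  have dQ: "x m - x n \<in> dom Q" for m n using dS sub by blast
  have "Cauchy x"
  proof (rule CauchyI)
    fix e :: real assume e: "0 < e"
    then have "0 < c * e\<^sup>2" using c by simp
    then obtain N where N: "\<forall>m\<ge>N. \<forall>n\<ge>N. the (shift_form l Q (x m - x n)) < c * e\<^sup>2"
      using Cx unfolding form_Cauchy_def by blast
    have "norm (x m - x n) < e" if "m \<ge> N" "n \<ge> N" for m n
    proof -
      have "c * (norm (x m - x n))\<^sup>2 < c * e\<^sup>2" using N that coercive[OF dS, of m n] by fastforce
      then have "(norm (x m - x n))\<^sup>2 < e\<^sup>2" using c by simp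
      then show ?thesis using e by (simp add: power2_less_imp_less)
    qed
    then show "\<exists>M. \<forall>m\<ge>M. \<forall>n\<ge>M. norm (x m - x n) < e" by blast
  qed
  then obtain u where u: "x \<longlonglongrightarrow> u" using Cauchy_convergent convergent_def by blast
  have "form_Cauchy Q x"
    by (rule form_Cauchy_mono[OF Cx]) (simp add: the_shift_form[OF dQ] l)
  then have uQ: "u \<in> dom Q" and lim: "(\<lambda>n. the (Q (x n - u))) \<longlonglongrightarrow> 0"
    using closed_formD[OF cf, of x u] xQ u by blast+
  have uS: "u \<in> S" using S_closed[of x u] xS u uQ lim by blast
  have "(\<lambda>n. norm (x n - u)) \<longlonglongrightarrow> 0"
    using u by (simp add: tendsto_norm_zero LIM_zero)
  then have "(\<lambda>n. the (Q (x n - u)) + l * (norm (x n - u))\<^sup>2) \<longlonglongrightarrow> 0 + l * 0\<^sup>2"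
    by (intro tendsto_add tendsto_mult tendsto_power tendsto_const lim)
  moreover have "x n - u \<in> dom Q" for n
    using csubspace_diff[OF form_csubspace[OF pf] xQ uQ] .
  ultimately have "(\<lambda>n. the (shift_form l Q (x n - u))) \<longlonglongrightarrow> 0"
    by (simp add: the_shift_form)
  with uS show "\<exists>u\<in>S. (\<lambda>n. the (shift_form l Q (x n - u))) \<longlonglongrightarrow> 0" by blast
qed

text \<open>The equation \<open>(H + l) v = f\<close> in weak form, solved by minimising \<open>Q[v] + l \<parallel>v\<parallel>\<^sup>2 - 2 Re \<langle>f, v\<rangle>\<close>, which is
  bounded below after completing the square.\<close>

lemma form_resolvent_exists:
  assumes cf: "closed_form Q" and l: "0 < l"
  shows "\<exists>v\<in>dom Q. \<forall>w\<in>dom Q. sesq Q v w + complex_of_real l * cinner v w = cinner f w"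
proof -
  note pf = closed_form_positive[OF cf]
  have "\<exists>v\<in>dom Q. \<forall>w\<in>dom Q. sesq (shift_form l Q) v w = cinner f w"
  proof (rule form_variational)
    show "positive_form (shift_form l Q)" using shift_form_positive[OF pf] l by simp
    show "form_complete_on (shift_form l Q) (dom Q)"
      by (rule closed_form_complete_on[OF cf _ l])
        (use l in \<open>simp_all add: form_csubspace[OF pf] the_shift_form form_nonneg[OF pf]\<close>)
    fix v assume v: "v \<in> dom Q"
    have "0 \<le> l * (norm (v - (1 / l) *\<^sub>R f))\<^sup>2" using l by simp
    also have "\<dots> = l * (norm v)\<^sup>2 - 2 * inner f v + (norm f)\<^sup>2 / l"
      using l by (simp add: power2_norm_eq_inner inner_diff_left inner_diff_right inner_commute[of v f]) (simp add: field_simps)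
    finally show "- (norm f)\<^sup>2 / l \<le> the (shift_form l Q v) - 2 * Re (cinner f v)"
      using form_nonneg[OF pf v] by (simp add: the_shift_form[OF v] inner_Re_cinner)
  qed (simp_all add: form_csubspace[OF pf] cinner_add_right cinner_scaleC_right)
  then show ?thesis using sesq_shift_form[OF pf less_imp_le[OF l]] by simp
qed

section \<open>Closedness and lower semicontinuity\<close>

definition form_epigraph :: "('a::chilbert_space \<rightharpoonup> real) \<Rightarrow> ('a \<times> real) set" where
  "form_epigraph Q = {(u, r). u \<in> dom Q \<and> the (Q u) \<le> r}"

text \<open>A closed form is lower semicontinuous. Replacing an arbitrary sequence \<open>z\<^sub>n \<rightarrow> (u, r)\<close> in the epigraph by
  near-minimisers \<open>y\<^sub>k\<close> of \<open>Q\<close> on shrinking balls around \<open>u\<close> does not increase the energy and makes the sequence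
  Cauchy: the infima over the balls increase to a limit, and midpoints remain in the larger
  ball.\<close>

lemma closed_form_epigraph_closed:
  assumes cf: "closed_form Q"
  shows "closed (form_epigraph Q)"
  unfolding closed_sequential_limits
proof (intro allI impI, elim conjE)
  fix z p assume z: "\<forall>n. z n \<in> form_epigraph Q" and "z \<longlonglongrightarrow> p"
  obtain u r where p: "p = (u, r)" by fastforce
  note pf = closed_form_positive[OF cf]
  have zu: "(\<lambda>n. fst (z n)) \<longlonglongrightarrow> u" and zr: "(\<lambda>n. snd (z n)) \<longlonglongrightarrow> r"
    using tendsto_fst[OF \<open>z \<longlonglongrightarrow> p\<close>] tendsto_snd[OF \<open>z \<longlonglongrightarrow> p\<close>] by (simp_all add: p)
  define K where "K k = {y \<in> dom Q. norm (y - u) \<le> 1 / real (Suc k)}" for k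
  define a where "a k = Inf ((\<lambda>y. the (Q y)) ` K k)" for k
  have bdd: "bdd_below ((\<lambda>y. the (Q y)) ` K k)" for k
    using form_nonneg[OF pf] by (auto simp: K_def intro!: bdd_belowI2[of _ 0])
  have a_le: "a k \<le> the (Q y)" if "y \<in> K k" for k y
    unfolding a_def using bdd that by (rule cINF_lower)
  have K_approx: "\<exists>y\<in>K k. the (Q y) < r + e" if "0 < e" for k e
  proof -
    have "\<forall>\<^sub>F n in sequentially. dist (fst (z n)) u < 1 / real (Suc k)"
      using tendstoD[OF zu] by simp
    moreover have "\<forall>\<^sub>F n in sequentially. snd (z n) < r + e"
      using order_tendstoD(2)[OF zr] that by simp
    ultimately have "\<forall>\<^sub>F n in sequentially.
        dist (fst (z n)) u < 1 / real (Suc k) \<and> snd (z n) < r + e"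
      by (rule eventually_conj)
    from eventually_happens'[OF sequentially_bot this]
    obtain n where n: "dist (fst (z n)) u < 1 / real (Suc k)" "snd (z n) < r + e"
      by blast
    moreover have "fst (z n) \<in> dom Q" "the (Q (fst (z n))) \<le> snd (z n)"
      using z unfolding form_epigraph_def by (auto simp: case_prod_beta)
    ultimately have "fst (z n) \<in> K k \<and> the (Q (fst (z n))) < r + e"
      unfolding K_def mem_Collect_eq dist_norm by argo
    then show ?thesis by blast
  qed
  have a_r: "a k \<le> r" for k
  proof (rule field_le_epsilon)
    fix e :: real assume "0 < e"
    with K_approx obtain y where "y \<in> K k" "the (Q y) < r + e" by blast
    with a_le[of y k] show "a k \<le> r + e" by simp
  qed
  have K_ne: "K k \<noteq> {}" for k using K_approx[of 1 k] by auto
  have "\<exists>y\<in>K k. the (Q y) < a k + 1 / real (Suc k)" for k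
    using cInf_lessD[of "(\<lambda>y. the (Q y)) ` K k" "a k + 1 / real (Suc k)"] K_ne
    by (auto simp: a_def)
  then obtain y where yK: "\<And>k. y k \<in> K k"
    and ya: "\<And>k. the (Q (y k)) < a k + 1 / real (Suc k)" by metis
  have yQ: "y k \<in> dom Q" for k using yK[of k] by (simp add: K_def)
  have K_anti: "K j \<subseteq> K i" if "i \<le> j" for i j
  proof -
    have "1 / real (Suc j) \<le> 1 / real (Suc i)" using that by (simp add: frac_le)
    then show ?thesis unfolding K_def by force
  qed
  have a_mono: "a i \<le> a j" if "i \<le> j" for i j
    unfolding a_def by (rule cINF_superset_mono[OF K_ne bdd K_anti[OF that]]) simp
  then have "incseq a" by (simp add: incseq_def)
  then obtain A where A: "a \<longlonglongrightarrow> A" and aA: "\<And>i. a i \<le> A"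
    using incseq_convergent[of a r] a_r by blast
  have "form_Cauchy Q y"
  proof (rule form_CauchyI[OF pf yQ])
    have "(\<lambda>i. 2 * (A - a i) + 4 / real (Suc i)) \<longlonglongrightarrow> 2 * (A - A) + 0"
      by (intro tendsto_add tendsto_mult tendsto_diff tendsto_const A inverse_Suc_tendsto_zero)
    then show "(\<lambda>i. 2 * (A - a i) + 4 / real (Suc i)) \<longlonglongrightarrow> 0" by simp
    fix i j :: nat assume ij: "i \<le> j"
    let ?m = "(1/2) *\<^sub>R (y i + y j)"
    have yj: "y j \<in> K i" using K_anti[OF ij] yK by blast
    have "?m - u = (1/2) *\<^sub>R (y i - u) + (1/2) *\<^sub>R (y j - u)"
    proof -
      have "(1/2) *\<^sub>R (y i - u) + (1/2) *\<^sub>R (y j - u) = ?m - ((1/2) *\<^sub>R u + (1/2) *\<^sub>R u)"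
        by (simp only: scaleR_right_diff_distrib scaleR_add_right) simp
      also have "(1/2) *\<^sub>R u + (1/2) *\<^sub>R u = u"
        by (simp flip: scaleR_add_left)
      finally show ?thesis by simp
    qed
    then have "norm (?m - u) \<le> norm (y i - u) / 2 + norm (y j - u) / 2"
      using norm_triangle_ineq[of "(1/2) *\<^sub>R (y i - u)" "(1/2) *\<^sub>R (y j - u)"] by simp
    also have "\<dots> \<le> 1 / real (Suc i)" using yK[of i] yj by (simp add: K_def)
    finally have "?m \<in> K i"
      unfolding K_def by (simp add: csubspace_scaleR csubspace_add form_csubspace[OF pf] yQ)
    from a_le[OF this] have "a i \<le> (the (Q (y i)) + the (Q (y j))) / 2 - the (Q (y i - y j)) / 4"
      by (simp only: form_midpoint[OF pf yQ yQ])
    moreover have "1 / real (Suc j) \<le> 1 / real (Suc i)" using ij by (simp add: frac_le)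
    ultimately have "the (Q (y i - y j)) \<le> 2 * (A - a i) + 4 * (1 / real (Suc i))"
      using ya[of i] ya[of j] aA[of j] by argo
    then show "the (Q (y i - y j)) \<le> 2 * (A - a i) + 4 / real (Suc i)" by simp
  qed
  moreover have "y \<longlonglongrightarrow> u"
  proof -
    have "(\<lambda>k. y k - u) \<longlonglongrightarrow> 0"
      by (rule Lim_null_comparison[OF _ inverse_Suc_tendsto_zero[of 1]])
        (use yK in \<open>simp add: K_def\<close>)
    then show ?thesis by (rule LIM_zero_cancel)
  qed
  ultimately have u: "u \<in> dom Q" and lim: "(\<lambda>k. the (Q (y k - u))) \<longlonglongrightarrow> 0"
    using closed_formD[OF cf, of y u] yQ by blast+
  have "(\<lambda>k. r + 1 / real (Suc k)) \<longlonglongrightarrow> r + 0"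
    by (intro tendsto_add tendsto_const inverse_Suc_tendsto_zero)
  moreover have "the (Q (y k)) \<le> r + 1 / real (Suc k)" for k using ya[of k] a_r[of k] by simp
  ultimately have "the (Q u) \<le> r + 0"
    by (intro LIMSEQ_le[OF form_tendsto[OF pf yQ u lim]]) blast+
  with u show "p \<in> form_epigraph Q" by (simp add: p form_epigraph_def)
qed

text \<open>If \<open>Q[x\<^sub>m - x\<^sub>n] < e\<close> for large \<open>m\<close> and \<open>n\<close>, then letting \<open>n\<close> tend to infinity keeps
  \<open>(x\<^sub>m - u, e)\<close> in the epigraph.\<close>

lemma closed_formI_epigraph:
  assumes pf: "positive_form Q" and cl: "closed (form_epigraph Q)"
  shows "closed_form Q"
  unfolding closed_form_def form_Cauchy_def[symmetric]
proof (intro conjI[OF pf] allI impI, elim conjE)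
  fix x u assume x: "\<forall>n. x n \<in> dom Q" and xu: "x \<longlonglongrightarrow> u" and Cx: "form_Cauchy Q x"
  have tail: "\<exists>N. \<forall>m\<ge>N. (x m - u, e) \<in> form_epigraph Q" if "0 < e" for e
  proof -
    obtain N where N: "\<forall>m\<ge>N. \<forall>n\<ge>N. the (Q (x m - x n)) < e"
      using Cx \<open>0 < e\<close> unfolding form_Cauchy_def by blast
    have "(x m - u, e) \<in> form_epigraph Q" if "m \<ge> N" for m
    proof (rule Lim_in_closed_set[OF cl _ sequentially_bot])
      show "((\<lambda>n. (x m - x n, e)) \<longlongrightarrow> (x m - u, e)) sequentially"
        by (intro tendsto_Pair tendsto_diff tendsto_const xu)
      have "(x m - x n, e) \<in> form_epigraph Q" if "n \<ge> N" for n
      proof -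
        have "x m - x n \<in> dom Q" using x by (simp add: csubspace_diff form_csubspace[OF pf])
        then show ?thesis using N \<open>m \<ge> N\<close> that less_imp_le by (auto simp: form_epigraph_def)
      qed
      then show "\<forall>\<^sub>F n in sequentially. (x m - x n, e) \<in> form_epigraph Q"
        unfolding eventually_sequentially by blast
    qed
    then show ?thesis by blast
  qed
  obtain N where "\<forall>m\<ge>N. (x m - u, 1) \<in> form_epigraph Q" using tail[of 1] by auto
  then have "x N - u \<in> dom Q" by (simp add: form_epigraph_def)
  then have "x N - (x N - u) \<in> dom Q" using x by (simp only: csubspace_diff form_csubspace[OF pf])
  then have "u \<in> dom Q" by simp
  moreover have "(\<lambda>n. the (Q (x n - u))) \<longlonglongrightarrow> 0"
  proof (rule LIMSEQ_I)
    fix e :: real assume "0 < e"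
    then obtain N where N: "\<forall>m\<ge>N. (x m - u, e / 2) \<in> form_epigraph Q" using tail[of "e/2"] by auto
    have "norm (the (Q (x m - u)) - 0) < e" if "m \<ge> N" for m
    proof -
      have "x m - u \<in> dom Q" and "the (Q (x m - u)) \<le> e / 2"
        using N that by (simp_all add: form_epigraph_def)
      then show ?thesis using form_nonneg[OF pf, of "x m - u"] \<open>0 < e\<close> by simp
    qed
    then show "\<exists>no. \<forall>n\<ge>no. norm (the (Q (x n - u)) - 0) < e" by blast
  qed
  ultimately show "u \<in> dom Q \<and> (\<lambda>n. the (Q (x n - u))) \<longlonglongrightarrow> 0" by blast
qed

section \<open>The relaxation of a positive form\<close>

text \<open>The lower semicontinuous envelope: its epigraph is the closure of the epigraph of \<open>Q\<close>
  (\<open>epigraph_relaxation\<close>), whose fibres over points of \<open>H\<close> are closed half-lines.\<close>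

definition relaxation :: "('a::chilbert_space \<rightharpoonup> real) \<Rightarrow> ('a \<rightharpoonup> real)" where
  "relaxation Q w =
     (if \<exists>r. (w, r) \<in> closure (form_epigraph Q)
      then Some (Inf {r. (w, r) \<in> closure (form_epigraph Q)}) else None)"

text \<open>A recovery sequence in the sense of Gamma-convergence. Such sequences carry the algebra of \<open>Q\<close> over to the
  relaxation, because they are stable under linear combinations.\<close>

definition recovers :: "('a::chilbert_space \<rightharpoonup> real) \<Rightarrow> (nat \<Rightarrow> 'a) \<Rightarrow> 'a \<Rightarrow> bool" where
  "recovers Q x w \<longleftrightarrow> (\<forall>n. x n \<in> dom Q) \<and> x \<longlonglongrightarrow> w \<and>
     (\<lambda>n. the (Q (x n))) \<longlonglongrightarrow> the (relaxation Q w)"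

lemma positive_form_restrict:
  assumes pf: "positive_form C" and S: "csubspace S" and sub: "S \<subseteq> dom C"
  shows "positive_form (C |` S)"
proof (rule positive_formI[of _ "sesq C"])
  have d: "dom (C |` S) = S" using sub by auto
  have in_dom: "u \<in> dom C" if "u \<in> S" for u using sub that by blast
  show "csubspace (dom (C |` S))" by (simp only: d S)
  show "sesquilinear_on (dom (C |` S)) (sesq C)"
    unfolding d sesquilinear_on_def
    by (simp add: in_dom sesq_add_left[OF pf] sesq_add_right[OF pf] sesq_scaleC_left[OF pf]
        sesq_scaleC_right[OF pf])
  show "sesq C u u = complex_of_real (the ((C |` S) u))" "0 \<le> the ((C |` S) u)"
    if "u \<in> dom (C |` S)" for u
    using that[unfolded d] by (simp_all add: sesq_self[OF pf] form_nonneg[OF pf] in_dom)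
qed

context
  fixes Q :: "'a::chilbert_space \<rightharpoonup> real"
  assumes pf: "positive_form Q"
begin

lemma epigraph_closure_nonneg: "(w, r) \<in> closure (form_epigraph Q) \<Longrightarrow> 0 \<le> r"
proof -
  have "form_epigraph Q \<subseteq> UNIV \<times> {0..}"
    using form_nonneg[OF pf] by (force simp: form_epigraph_def)
  then have "closure (form_epigraph Q) \<subseteq> UNIV \<times> {0..}"
    by (rule closure_minimal) (intro closed_Times closed_UNIV closed_atLeast)
  then show "(w, r) \<in> closure (form_epigraph Q) \<Longrightarrow> 0 \<le> r" by auto
qed

lemma relaxation_le:
  assumes "(w, r) \<in> closure (form_epigraph Q)"
  shows "w \<in> dom (relaxation Q)" and "the (relaxation Q w) \<le> r"
proof -
  show "w \<in> dom (relaxation Q)" using assms by (auto simp: relaxation_def)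
  have "bdd_below {r. (w, r) \<in> closure (form_epigraph Q)}"
    by (rule bdd_belowI[of _ 0]) (use epigraph_closure_nonneg in blast)
  then have "Inf {r. (w, r) \<in> closure (form_epigraph Q)} \<le> r"
    using assms by (intro cInf_lower) auto
  then show "the (relaxation Q w) \<le> r" using assms by (auto simp: relaxation_def)
qed

lemma relaxation_in_closure:
  assumes "w \<in> dom (relaxation Q)"
  shows "(w, the (relaxation Q w)) \<in> closure (form_epigraph Q)"
proof -
  let ?R = "{r. (w, r) \<in> closure (form_epigraph Q)}"
  have ne: "\<exists>r. (w, r) \<in> closure (form_epigraph Q)"
    using assms by (auto simp: relaxation_def split: if_splits)
  have "closed ((\<lambda>r. (w, r)) -` closure (form_epigraph Q))"
    by (intro closed_vimage closed_closure continuous_intros)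
  then have "closed ?R" by (simp add: vimage_def)
  moreover have "bdd_below ?R"
    by (rule bdd_belowI[of _ 0]) (use epigraph_closure_nonneg in blast)
  ultimately have "Inf ?R \<in> ?R" using ne by (intro closed_contains_Inf) auto
  then show ?thesis using ne by (simp add: relaxation_def)
qed

lemma relaxation_nonneg: "w \<in> dom (relaxation Q) \<Longrightarrow> 0 \<le> the (relaxation Q w)"
  using relaxation_in_closure epigraph_closure_nonneg by blast

text \<open>The upper half of the sequential description of the envelope; \<open>relaxation_liminf\<close> is the lower half.\<close>

lemma relaxation_le_lim:
  assumes x: "\<And>n. x n \<in> dom Q" and xw: "x \<longlonglongrightarrow> w"
    and le: "\<And>n. the (Q (x n)) \<le> s n" and s: "s \<longlonglongrightarrow> r"
  shows "w \<in> dom (relaxation Q)" and "the (relaxation Q w) \<le> r"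
proof -
  have "(w, r) \<in> closure (form_epigraph Q)"
    unfolding closure_sequential
    by (rule exI[of _ "\<lambda>n. (x n, s n)"])
      (use x le xw s in \<open>auto simp: form_epigraph_def intro!: tendsto_Pair\<close>)
  then show "w \<in> dom (relaxation Q)" and "the (relaxation Q w) \<le> r"
    using relaxation_le by blast+
qed

lemma relaxation_liminf:
  assumes x: "\<And>n. x n \<in> dom Q" and xw: "x \<longlonglongrightarrow> w" and r: "r < the (relaxation Q w)"
  shows "\<forall>\<^sub>F n in sequentially. r < the (Q (x n))"
proof -
  have "(w, r) \<notin> closure (form_epigraph Q)" using relaxation_le(2) r by fastforce
  then have "(w, r) \<in> - closure (form_epigraph Q)" by simp
  then have "\<forall>\<^sub>F n in sequentially. (x n, r) \<in> - closure (form_epigraph Q)"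
    by (intro topological_tendstoD[of _ "(w, r)"] tendsto_Pair xw tendsto_const open_Compl closed_closure)
  then show ?thesis
  proof eventually_elim
    case (elim n)
    then have "(x n, r) \<notin> form_epigraph Q" using closure_subset by blast
    then show ?case using x by (auto simp: form_epigraph_def)
  qed
qed

lemma recovers_exists:
  assumes "w \<in> dom (relaxation Q)" obtains x where "recovers Q x w"
proof -
  obtain z where z: "\<forall>n. z n \<in> form_epigraph Q" and lim: "z \<longlonglongrightarrow> (w, the (relaxation Q w))"
    using relaxation_in_closure[OF assms] unfolding closure_sequential by blast
  have x: "fst (z n) \<in> dom Q" and le: "the (Q (fst (z n))) \<le> snd (z n)" for n
    using z by (auto simp: form_epigraph_def case_prod_beta)
  have xw: "(\<lambda>n. fst (z n)) \<longlonglongrightarrow> w"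
    and s: "(\<lambda>n. snd (z n)) \<longlonglongrightarrow> the (relaxation Q w)"
    using tendsto_fst[OF lim] tendsto_snd[OF lim] by simp_all
  have "(\<lambda>n. the (Q (fst (z n)))) \<longlonglongrightarrow> the (relaxation Q w)"
  proof (rule order_tendstoI)
    fix r assume "r < the (relaxation Q w)"
    then show "\<forall>\<^sub>F n in sequentially. r < the (Q (fst (z n)))"
      by (rule relaxation_liminf[OF x xw])
  next
    fix r assume "the (relaxation Q w) < r"
    then have "\<forall>\<^sub>F n in sequentially. snd (z n) < r" by (rule order_tendstoD(2)[OF s])
    then show "\<forall>\<^sub>F n in sequentially. the (Q (fst (z n))) < r"
      by eventually_elim (use le le_less_trans in blast)
  qed
  with x xw have "recovers Q (\<lambda>n. fst (z n)) w" by (simp add: recovers_def)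
  then show thesis by (rule that)
qed

lemma recoversD:
  assumes "recovers Q x w"
  shows "x n \<in> dom Q" "x \<longlonglongrightarrow> w" "(\<lambda>n. the (Q (x n))) \<longlonglongrightarrow> the (relaxation Q w)"
  using assms by (auto simp: recovers_def)

lemma relaxation_le_form:
  assumes "u \<in> dom Q"
  shows "u \<in> dom (relaxation Q)" "the (relaxation Q u) \<le> the (Q u)"
proof -
  have "(u, the (Q u)) \<in> form_epigraph Q" using assms by (simp add: form_epigraph_def)
  then have "(u, the (Q u)) \<in> closure (form_epigraph Q)" using closure_subset by blast
  then show "u \<in> dom (relaxation Q)" "the (relaxation Q u) \<le> the (Q u)"
    using relaxation_le by blast+
qed

lemma relaxation_zero: "the (relaxation Q 0) = 0"
  using relaxation_le_form[of 0] relaxation_nonneg[of 0] form_zero[OF pf]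
    csubspace_zero[OF form_csubspace[OF pf]] by fastforce

lemma relaxation_scaleC_le:
  assumes w: "w \<in> dom (relaxation Q)"
  shows "c *\<^sub>C w \<in> dom (relaxation Q)"
    and "the (relaxation Q (c *\<^sub>C w)) \<le> (cmod c)\<^sup>2 * the (relaxation Q w)"
proof -
  obtain x where x: "recovers Q x w" using recovers_exists[OF w] .
  note xd = recoversD[OF x]
  have d: "c *\<^sub>C x n \<in> dom Q" for n
    using xd(1) by (simp add: csubspace_scaleC form_csubspace[OF pf])
  have le: "the (Q (c *\<^sub>C x n)) \<le> (cmod c)\<^sup>2 * the (Q (x n))" for n
    using form_scaleC[OF pf xd(1)] by simp
  have lim: "(\<lambda>n. (cmod c)\<^sup>2 * the (Q (x n))) \<longlonglongrightarrow> (cmod c)\<^sup>2 * the (relaxation Q w)"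
    by (intro tendsto_mult tendsto_const xd(3))
  show "c *\<^sub>C w \<in> dom (relaxation Q)"
    and "the (relaxation Q (c *\<^sub>C w)) \<le> (cmod c)\<^sup>2 * the (relaxation Q w)"
    by (rule relaxation_le_lim[OF d continuous_scaleC[OF xd(2)] le lim])+
qed

text \<open>Scaling back by \<open>inverse c\<close> turns the inequality into an equality.\<close>

lemma relaxation_scaleC:
  assumes w: "w \<in> dom (relaxation Q)"
  shows "the (relaxation Q (c *\<^sub>C w)) = (cmod c)\<^sup>2 * the (relaxation Q w)"
proof (cases "c = 0")
  case True
  then show ?thesis by (simp add: scaleC_zero relaxation_zero)
next
  case False
  have "inverse c *\<^sub>C c *\<^sub>C w = w" using False by (simp add: scaleC_scaleC scaleC_one)
  then have "the (relaxation Q w) \<le> (cmod (inverse c))\<^sup>2 * the (relaxation Q (c *\<^sub>C w))"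
    using relaxation_scaleC_le(2)[OF relaxation_scaleC_le(1)[OF w], of "inverse c" c] by simp
  then have "(cmod c)\<^sup>2 * the (relaxation Q w) \<le> the (relaxation Q (c *\<^sub>C w))"
    using False by (simp add: norm_inverse norm_divide field_simps)
  with relaxation_scaleC_le(2)[OF w, of c] show ?thesis by simp
qed

lemma recovers_scaleC:
  assumes w: "w \<in> dom (relaxation Q)" and x: "recovers Q x w"
  shows "recovers Q (\<lambda>n. c *\<^sub>C x n) (c *\<^sub>C w)"
proof -
  note xd = recoversD[OF x]
  have "(\<lambda>n. (cmod c)\<^sup>2 * the (Q (x n))) \<longlonglongrightarrow> (cmod c)\<^sup>2 * the (relaxation Q w)"
    by (intro tendsto_mult tendsto_const xd(3))
  then show ?thesis
    using xd(1,2) unfolding recovers_def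
    by (simp add: csubspace_scaleC form_csubspace[OF pf] continuous_scaleC form_scaleC[OF pf]
        relaxation_scaleC[OF w])
qed

text \<open>The parallelogram law along recovery sequences \<open>x\<close> of \<open>u\<close> and \<open>y\<close> of \<open>v\<close>. It survives in the limit as an
  inequality only, since \<open>x\<^sub>n \<plusminus> y\<^sub>n\<close> is not yet known to recover \<open>u \<plusminus> v\<close>.\<close>

lemma relaxation_subadditive:
  assumes u: "u \<in> dom (relaxation Q)" and v: "v \<in> dom (relaxation Q)"
  shows "u + v \<in> dom (relaxation Q)" "u - v \<in> dom (relaxation Q)"
    and "the (relaxation Q (u + v)) + the (relaxation Q (u - v))
      \<le> 2 * the (relaxation Q u) + 2 * the (relaxation Q v)" (is "?p + ?m \<le> ?s")
proof -
  obtain x y where x: "recovers Q x u" and y: "recovers Q y v"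
    using recovers_exists[OF u] recovers_exists[OF v] by metis
  note xd = recoversD[OF x] and yd = recoversD[OF y]
  have p: "x n + y n \<in> dom Q" and m: "x n - y n \<in> dom Q" for n
    using xd(1)[of n] yd(1)[of n]
    by (simp_all add: csubspace_add csubspace_diff form_csubspace[OF pf])
  have plim: "(\<lambda>n. x n + y n) \<longlonglongrightarrow> u + v" and mlim: "(\<lambda>n. x n - y n) \<longlonglongrightarrow> u - v"
    by (intro tendsto_add tendsto_diff xd(2) yd(2))+
  have lim: "(\<lambda>n. 2 * the (Q (x n)) + 2 * the (Q (y n))) \<longlonglongrightarrow> ?s"
    by (intro tendsto_add tendsto_mult tendsto_const xd(3) yd(3))
  have par: "the (Q (x n + y n)) + the (Q (x n - y n)) = 2 * the (Q (x n)) + 2 * the (Q (y n))" for n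
    by (rule form_parallelogram[OF pf xd(1) yd(1)])
  have "the (Q (x n + y n)) \<le> 2 * the (Q (x n)) + 2 * the (Q (y n))"
      "the (Q (x n - y n)) \<le> 2 * the (Q (x n)) + 2 * the (Q (y n))" for n
    using par[of n] form_nonneg[OF pf p, of n] form_nonneg[OF pf m, of n] by linarith+
  then show "u + v \<in> dom (relaxation Q)" "u - v \<in> dom (relaxation Q)"
    using relaxation_le_lim(1)[OF p plim _ lim] relaxation_le_lim(1)[OF m mlim _ lim] by blast+
  show "?p + ?m \<le> ?s"
  proof (rule field_le_epsilon)
    fix e :: real assume e: "0 < e"
    have "\<forall>\<^sub>F n in sequentially. ?p - e/2 < the (Q (x n + y n))"
      by (rule relaxation_liminf[OF p plim]) (use e in simp)
    moreover have "\<forall>\<^sub>F n in sequentially. ?m - e/2 < the (Q (x n - y n))"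
      by (rule relaxation_liminf[OF m mlim]) (use e in simp)
    ultimately have "\<forall>\<^sub>F n in sequentially. ?p + ?m - e \<le> 2 * the (Q (x n)) + 2 * the (Q (y n))"
    proof eventually_elim
      case (elim n)
      then show ?case using par[of n] by argo
    qed
    then have "?p + ?m - e \<le> ?s"
      by (rule tendsto_lowerbound[OF lim _ sequentially_bot])
    then show "?p + ?m \<le> ?s + e" by simp
  qed
qed

text \<open>The reverse inequality is the previous one for \<open>u + v\<close> and \<open>u - v\<close>, whose sum and difference
  are \<open>2 u\<close> and \<open>2 v\<close>.\<close>

lemma relaxation_parallelogram:
  assumes u: "u \<in> dom (relaxation Q)" and v: "v \<in> dom (relaxation Q)"
  shows "the (relaxation Q (u + v)) + the (relaxation Q (u - v))
      = 2 * the (relaxation Q u) + 2 * the (relaxation Q v)"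
proof (rule antisym[OF relaxation_subadditive(3)[OF u v]])
  have two: "(u + v) + (u - v) = 2 *\<^sub>C u" "(u + v) - (u - v) = 2 *\<^sub>C v"
    using scaleC_add_left[of 1 1 u] scaleC_add_left[of 1 1 v] by (simp_all add: scaleC_one)
  have "4 * the (relaxation Q u) + 4 * the (relaxation Q v)
      \<le> 2 * the (relaxation Q (u + v)) + 2 * the (relaxation Q (u - v))"
    using relaxation_subadditive(3)[OF relaxation_subadditive(1,2)[OF u v], unfolded two]
    by (simp add: relaxation_scaleC u v)
  then show "2 * the (relaxation Q u) + 2 * the (relaxation Q v)
      \<le> the (relaxation Q (u + v)) + the (relaxation Q (u - v))" by simp
qed

text \<open>The sum of the energies of \<open>x\<^sub>n + y\<^sub>n\<close> and \<open>x\<^sub>n - y\<^sub>n\<close> converges to the sum of the relaxed energies, and neither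
  energy can fall below its own relaxed value in the limit, so both converge.\<close>

lemma recovers_add:
  assumes u: "u \<in> dom (relaxation Q)" and v: "v \<in> dom (relaxation Q)"
    and x: "recovers Q x u" and y: "recovers Q y v"
  shows "recovers Q (\<lambda>n. x n + y n) (u + v)"
proof -
  note xd = recoversD[OF x] and yd = recoversD[OF y]
  let ?p = "the (relaxation Q (u + v))" and ?m = "the (relaxation Q (u - v))"
  have p: "x n + y n \<in> dom Q" and m: "x n - y n \<in> dom Q" for n
    using xd(1)[of n] yd(1)[of n]
    by (simp_all add: csubspace_add csubspace_diff form_csubspace[OF pf])
  have plim: "(\<lambda>n. x n + y n) \<longlonglongrightarrow> u + v" and mlim: "(\<lambda>n. x n - y n) \<longlonglongrightarrow> u - v"
    by (intro tendsto_add tendsto_diff xd(2) yd(2))+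
  have "(\<lambda>n. 2 * the (Q (x n)) + 2 * the (Q (y n)))
      \<longlonglongrightarrow> 2 * the (relaxation Q u) + 2 * the (relaxation Q v)"
    by (intro tendsto_add tendsto_mult tendsto_const xd(3) yd(3))
  then have lim: "(\<lambda>n. the (Q (x n + y n)) + the (Q (x n - y n))) \<longlonglongrightarrow> ?p + ?m"
    by (simp only: form_parallelogram[OF pf xd(1) yd(1)] relaxation_parallelogram[OF u v])
  have "(\<lambda>n. the (Q (x n + y n))) \<longlonglongrightarrow> ?p"
  proof (rule order_tendstoI)
    fix r assume "r < ?p"
    then show "\<forall>\<^sub>F n in sequentially. r < the (Q (x n + y n))"
      by (rule relaxation_liminf[OF p plim])
  next
    fix r assume r: "?p < r"
    define e where "e = (r - ?p) / 2"
    have e: "0 < e" using r by (simp add: e_def)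
    have "\<forall>\<^sub>F n in sequentially. ?m - e < the (Q (x n - y n))"
      by (rule relaxation_liminf[OF m mlim]) (use e in simp)
    moreover have "\<forall>\<^sub>F n in sequentially. the (Q (x n + y n)) + the (Q (x n - y n)) < ?p + ?m + e"
      by (rule order_tendstoD(2)[OF lim]) (use e in simp)
    ultimately show "\<forall>\<^sub>F n in sequentially. the (Q (x n + y n)) < r"
    proof eventually_elim
      case (elim n)
      then show ?case by (simp add: e_def field_simps)
    qed
  qed
  with p plim show ?thesis by (simp add: recovers_def)
qed

text \<open>Polarization involves only linear combinations of \<open>x\<^sub>n\<close> and \<open>y\<^sub>n\<close>, which are recovery sequences. Sesquilinearity
  of the relaxation therefore passes to the limit from that of \<open>Q\<close>.\<close>

lemma sesq_recovers_tendsto: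
  assumes u: "u \<in> dom (relaxation Q)" and v: "v \<in> dom (relaxation Q)"
    and x: "recovers Q x u" and y: "recovers Q y v"
  shows "(\<lambda>n. sesq Q (x n) (y n)) \<longlonglongrightarrow> sesq (relaxation Q) u v"
  unfolding sesq_def
  by (intro tendsto_divide tendsto_sum tendsto_mult tendsto_const tendsto_of_real recoversD(3)
      recovers_add recovers_scaleC u v x y relaxation_scaleC_le(1)) simp

lemma relaxation_csubspace: "csubspace (dom (relaxation Q))"
  unfolding csubspace_def
  using relaxation_subadditive(1) relaxation_scaleC_le(1)
    relaxation_le_form(1)[OF csubspace_zero[OF form_csubspace[OF pf]]] by blast

lemma relaxation_positive: "positive_form (relaxation Q)"
proof (rule positive_formI[OF relaxation_csubspace])
  let ?D = "dom (relaxation Q)"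
  have add: "u + v \<in> ?D" if "u \<in> ?D" "v \<in> ?D" for u v using relaxation_subadditive(1) that .
  have scl: "c *\<^sub>C u \<in> ?D" if "u \<in> ?D" for c u using relaxation_scaleC_le(1) that .
  note lim = sesq_recovers_tendsto
  note eq = LIMSEQ_unique
  have sum: "sesq (relaxation Q) (u + v) w = sesq (relaxation Q) u w + sesq (relaxation Q) v w
      \<and> sesq (relaxation Q) w (u + v) = sesq (relaxation Q) w u + sesq (relaxation Q) w v"
    if u: "u \<in> ?D" and v: "v \<in> ?D" and w: "w \<in> ?D" for u v w
  proof -
    obtain x y z where x: "recovers Q x u" and y: "recovers Q y v" and z: "recovers Q z w"
      using recovers_exists[OF u] recovers_exists[OF v] recovers_exists[OF w] by metis
    have "(\<lambda>n. sesq Q (x n + y n) (z n)) \<longlonglongrightarrow> sesq (relaxation Q) (u + v) w"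
      by (rule lim[OF add[OF u v] w recovers_add[OF u v x y] z])
    moreover have "(\<lambda>n. sesq Q (x n + y n) (z n))
        \<longlonglongrightarrow> sesq (relaxation Q) u w + sesq (relaxation Q) v w"
      using tendsto_add[OF lim[OF u w x z] lim[OF v w y z]]
      by (simp add: sesq_add_left[OF pf recoversD(1)[OF x] recoversD(1)[OF y] recoversD(1)[OF z]])
    moreover have "(\<lambda>n. sesq Q (z n) (x n + y n)) \<longlonglongrightarrow> sesq (relaxation Q) w (u + v)"
      by (rule lim[OF w add[OF u v] z recovers_add[OF u v x y]])
    moreover have "(\<lambda>n. sesq Q (z n) (x n + y n))
        \<longlonglongrightarrow> sesq (relaxation Q) w u + sesq (relaxation Q) w v"
      using tendsto_add[OF lim[OF w u z x] lim[OF w v z y]]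
      by (simp add: sesq_add_right[OF pf recoversD(1)[OF x] recoversD(1)[OF y] recoversD(1)[OF z]])
    ultimately show ?thesis by (metis eq)
  qed
  have mult: "sesq (relaxation Q) (c *\<^sub>C u) v = c * sesq (relaxation Q) u v
      \<and> sesq (relaxation Q) u (c *\<^sub>C v) = cnj c * sesq (relaxation Q) u v"
    if u: "u \<in> ?D" and v: "v \<in> ?D" for c u v
  proof -
    obtain x y where x: "recovers Q x u" and y: "recovers Q y v"
      using recovers_exists[OF u] recovers_exists[OF v] by metis
    have "(\<lambda>n. sesq Q (c *\<^sub>C x n) (y n)) \<longlonglongrightarrow> sesq (relaxation Q) (c *\<^sub>C u) v"
      by (rule lim[OF scl[OF u] v recovers_scaleC[OF u x] y])
    moreover have "(\<lambda>n. sesq Q (c *\<^sub>C x n) (y n)) \<longlonglongrightarrow> c * sesq (relaxation Q) u v"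
      using tendsto_mult[OF tendsto_const lim[OF u v x y], of c]
      by (simp add: sesq_scaleC_left[OF pf recoversD(1)[OF x] recoversD(1)[OF y]])
    moreover have "(\<lambda>n. sesq Q (x n) (c *\<^sub>C y n)) \<longlonglongrightarrow> sesq (relaxation Q) u (c *\<^sub>C v)"
      by (rule lim[OF u scl[OF v] x recovers_scaleC[OF v y]])
    moreover have "(\<lambda>n. sesq Q (x n) (c *\<^sub>C y n)) \<longlonglongrightarrow> cnj c * sesq (relaxation Q) u v"
      using tendsto_mult[OF tendsto_const lim[OF u v x y], of "cnj c"]
      by (simp add: sesq_scaleC_right[OF pf recoversD(1)[OF x] recoversD(1)[OF y]])
    ultimately show ?thesis by (metis eq)
  qed
  show "sesquilinear_on ?D (sesq (relaxation Q))"
    unfolding sesquilinear_on_def using sum mult by blast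
  show "sesq (relaxation Q) u u = complex_of_real (the (relaxation Q u))" if u: "u \<in> ?D" for u
  proof -
    obtain x where x: "recovers Q x u" using recovers_exists[OF u] .
    have "(\<lambda>n. complex_of_real (the (Q (x n)))) \<longlonglongrightarrow> sesq (relaxation Q) u u"
      using lim[OF u u x x] by (simp add: sesq_self[OF pf recoversD(1)[OF x]])
    then show ?thesis using eq tendsto_of_real[OF recoversD(3)[OF x]] by blast
  qed
qed (rule relaxation_nonneg)

lemma epigraph_relaxation: "form_epigraph (relaxation Q) = closure (form_epigraph Q)"
proof
  show "closure (form_epigraph Q) \<subseteq> form_epigraph (relaxation Q)"
    using relaxation_le by (auto simp: form_epigraph_def)
  show "form_epigraph (relaxation Q) \<subseteq> closure (form_epigraph Q)"
  proof clarify
    fix w r assume wr: "(w, r) \<in> form_epigraph (relaxation Q)"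
    then have w: "w \<in> dom (relaxation Q)" and r: "the (relaxation Q w) \<le> r"
      by (simp_all add: form_epigraph_def)
    obtain x where x: "recovers Q x w" using recovers_exists[OF w] .
    note xd = recoversD[OF x]
    have "(\<lambda>n. the (Q (x n)) + (r - the (relaxation Q w)))
        \<longlonglongrightarrow> the (relaxation Q w) + (r - the (relaxation Q w))"
      by (intro tendsto_add tendsto_const xd(3))
    then have "(\<lambda>n. (x n, the (Q (x n)) + (r - the (relaxation Q w)))) \<longlonglongrightarrow> (w, r)"
      using xd(2) by (intro tendsto_Pair) simp_all
    moreover have "(x n, the (Q (x n)) + (r - the (relaxation Q w))) \<in> form_epigraph Q" for n
      using xd(1) r by (simp add: form_epigraph_def)
    ultimately show "(w, r) \<in> closure (form_epigraph Q)"
      unfolding closure_sequential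
      by (intro exI[of _ "\<lambda>n. (x n, the (Q (x n)) + (r - the (relaxation Q w)))"]) blast
  qed
qed

lemma relaxation_closed: "closed_form (relaxation Q)"
  by (rule closed_formI_epigraph[OF relaxation_positive]) (simp add: epigraph_relaxation)

text \<open>Recovery sequences converge in the form norm of the relaxation. Their relaxed energies do not exceed
  their energies, which tend to the relaxed energy of \<open>w\<close>, while lower semicontinuity bounds the
  energy of the midpoints \<open>(x\<^sub>n + w) / 2\<close> from below; the parallelogram law does the rest.\<close>

lemma relaxation_core:
  assumes w: "w \<in> dom (relaxation Q)" and x: "recovers Q x w"
  shows "(\<lambda>n. the (relaxation Q (x n - w))) \<longlonglongrightarrow> 0"
proof -
  let ?C = "relaxation Q"
  note xd = recoversD[OF x] and pC = relaxation_positive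
  have xC: "x n \<in> dom ?C" for n using relaxation_le_form(1) xd(1) .
  have dC: "x n - w \<in> dom ?C" for n using csubspace_diff[OF relaxation_csubspace xC w] .
  have mid: "(\<lambda>n. (1/2) *\<^sub>R (x n + w)) \<longlonglongrightarrow> w"
  proof -
    have "(\<lambda>n. (1/2) *\<^sub>R (x n + w)) \<longlonglongrightarrow> (1/2) *\<^sub>R (w + w)"
      by (intro tendsto_scaleR tendsto_add tendsto_const xd(2))
    then show ?thesis by (simp add: scaleR_half_double)
  qed
  have midC: "(1/2) *\<^sub>R (x n + w) \<in> dom ?C" for n
    using xC w by (simp add: csubspace_scaleR csubspace_add relaxation_csubspace)
  have mid_liminf: "\<forall>\<^sub>F n in sequentially. r < the (?C ((1/2) *\<^sub>R (x n + w)))"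
    if r: "r < the (?C w)" for r
  proof -
    have "(w, r) \<in> - form_epigraph ?C" using r by (simp add: form_epigraph_def)
    moreover have "open (- form_epigraph ?C)" by (simp add: epigraph_relaxation open_Compl)
    ultimately have "\<forall>\<^sub>F n in sequentially. ((1/2) *\<^sub>R (x n + w), r) \<in> - form_epigraph ?C"
      by (intro topological_tendstoD[of _ "(w, r)"] tendsto_Pair mid tendsto_const)
    then show ?thesis
    proof eventually_elim
      case (elim n)
      then show ?case using midC[of n] by (simp add: form_epigraph_def not_le)
    qed
  qed
  show ?thesis
  proof (rule order_tendstoI)
    fix r :: real assume "r < 0"
    then show "\<forall>\<^sub>F n in sequentially. r < the (?C (x n - w))"
      using form_nonneg[OF pC dC] by (simp add: less_le_trans)
  next
    fix r :: real assume r: "0 < r"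
    have "\<forall>\<^sub>F n in sequentially. the (?C w) - r / 8 < the (?C ((1/2) *\<^sub>R (x n + w)))"
      by (rule mid_liminf) (use r in simp)
    moreover have "\<forall>\<^sub>F n in sequentially. the (Q (x n)) < the (?C w) + r / 8"
      by (rule order_tendstoD(2)[OF xd(3)]) (use r in simp)
    ultimately show "\<forall>\<^sub>F n in sequentially. the (?C (x n - w)) < r"
    proof eventually_elim
      case (elim n)
      then show ?case
        using form_midpoint[OF pC xC w, of n] relaxation_le_form(2)[OF xd(1), of n] r by argo
    qed
  qed
qed

section \<open>The closure of the regular part\<close>

lemma relaxation_restrict:
  "dom (relaxation Q |` dom Q) = dom Q" "u \<in> dom Q \<Longrightarrow> (relaxation Q |` dom Q) u = relaxation Q u"
  using relaxation_le_form(1) by auto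

lemma relaxation_minorant:
  assumes dense: "closure (dom Q) = UNIV"
  shows "closable_minorant Q (relaxation Q |` dom Q)"
proof -
  have sub: "dom Q \<subseteq> dom (relaxation Q)" using relaxation_le_form(1) by blast
  have "positive_form (relaxation Q |` dom Q)"
    by (rule positive_form_restrict[OF relaxation_positive form_csubspace[OF pf] sub])
  moreover have "relaxation Q |` dom Q \<subseteq>\<^sub>m relaxation Q"
    by (simp add: map_le_def)
  ultimately show ?thesis
    unfolding closable_minorant_def closable_form_def
    using relaxation_closed relaxation_restrict relaxation_le_form(2) dense by auto
qed

text \<open>The closed extension \<open>C\<close> of a minorant has a closed epigraph, which contains the epigraph of \<open>Q\<close> and hence its
  closure.\<close>

lemma minorant_le_relaxation:
  assumes R: "closable_minorant Q R" and u: "u \<in> dom Q"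
  shows "the (R u) \<le> the (relaxation Q u)"
proof -
  obtain C where C: "closed_form C" and RC: "R \<subseteq>\<^sub>m C"
    using R by (auto simp: closable_minorant_def closable_form_def)
  have dR: "dom R = dom Q" and RQ: "\<And>v. v \<in> dom Q \<Longrightarrow> the (R v) \<le> the (Q v)"
    using R by (auto simp: closable_minorant_def)
  have eq: "R v = C v" if "v \<in> dom Q" for v using RC that dR by (auto simp: map_le_def)
  have "form_epigraph Q \<subseteq> form_epigraph C"
  proof
    fix p assume "p \<in> form_epigraph Q"
    then obtain v r where p: "p = (v, r)" and v: "v \<in> dom Q" and r: "the (Q v) \<le> r"
      by (auto simp: form_epigraph_def)
    have "v \<in> dom C" using eq[OF v] v dR by (metis domIff)
    then show "p \<in> form_epigraph C" using RQ[OF v] r eq[OF v] by (simp add: p form_epigraph_def)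
  qed
  then have "closure (form_epigraph Q) \<subseteq> form_epigraph C"
    by (rule closure_minimal) (rule closed_form_epigraph_closed[OF C])
  then have "(u, the (relaxation Q u)) \<in> form_epigraph C"
    using relaxation_in_closure[OF relaxation_le_form(1)[OF u]] by blast
  then show ?thesis using eq[OF u] by (simp add: form_epigraph_def)
qed

lemma regular_part_eq_relaxation:
  assumes dense: "closure (dom Q) = UNIV"
  shows "regular_part Q = relaxation Q |` dom Q"
  unfolding regular_part_def
proof (rule the_equality)
  show "closable_minorant Q (relaxation Q |` dom Q) \<and>
      (\<forall>R'. closable_minorant Q R' \<longrightarrow> (\<forall>u\<in>dom Q. the (R' u) \<le> the ((relaxation Q |` dom Q) u)))"
    using relaxation_minorant[OF dense] minorant_le_relaxation relaxation_restrict(2) by simp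
next
  fix R assume R: "closable_minorant Q R \<and>
      (\<forall>R'. closable_minorant Q R' \<longrightarrow> (\<forall>u\<in>dom Q. the (R' u) \<le> the (R u)))"
  have dR: "dom R = dom Q" using R by (simp add: closable_minorant_def)
  have eq: "the (R u) = the ((relaxation Q |` dom Q) u)" if u: "u \<in> dom Q" for u
  proof (rule antisym)
    show "the (R u) \<le> the ((relaxation Q |` dom Q) u)"
      using minorant_le_relaxation[OF conjunct1[OF R] u] u by simp
    show "the ((relaxation Q |` dom Q) u) \<le> the (R u)"
      using R relaxation_minorant[OF dense] u by blast
  qed
  show "R = relaxation Q |` dom Q"
  proof
    fix u
    show "R u = (relaxation Q |` dom Q) u"
    proof (cases "u \<in> dom Q")
      case True
      then have "u \<in> dom R" "u \<in> dom (relaxation Q |` dom Q)"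
        by (simp_all only: dR relaxation_restrict(1))
      then show ?thesis using eq[OF True] by (metis domIff option.expand)
    next
      case False
      then show ?thesis using dR by (metis domIff restrict_map_def)
    qed
  qed
qed

text \<open>A recovery sequence of \<open>w\<close> is Cauchy for the relaxation, and therefore for every closed form
  that agrees with the relaxation on \<open>dom Q\<close>. Such a form must contain \<open>w\<close>, with the same value.\<close>

lemma form_closure_relaxation_restrict: "form_closure (relaxation Q |` dom Q) = relaxation Q"
  unfolding form_closure_def
proof (rule the_equality)
  let ?C = "relaxation Q" and ?R = "relaxation Q |` dom Q"
  have RC: "?R \<subseteq>\<^sub>m ?C" by (simp add: map_le_def)
  have least: "?C \<subseteq>\<^sub>m C'" if C': "closed_form C'" and R: "?R \<subseteq>\<^sub>m C'" for C'
  proof -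
    note pC' = closed_form_positive[OF C'] and pC = relaxation_positive
    have eq: "C' v = ?C v" if "v \<in> dom Q" for v
      using R that relaxation_restrict unfolding map_le_def by metis
    have dC': "v \<in> dom C'" if "v \<in> dom Q" for v
      using eq[OF that] relaxation_le_form(1)[OF that] by (simp add: domIff)
    have "C' w = ?C w" if w: "w \<in> dom ?C" for w
    proof -
      obtain x where x: "recovers Q x w" using recovers_exists[OF w] .
      note xd = recoversD[OF x]
      have xC: "x n \<in> dom ?C" for n using relaxation_le_form(1) xd(1) .
      have dQ: "x m - x n \<in> dom Q" for m n
        using csubspace_diff[OF form_csubspace[OF pf] xd(1) xd(1)] .
      have core: "(\<lambda>n. the (?C (x n - w))) \<longlonglongrightarrow> 0" by (rule relaxation_core[OF w x])
      have "form_Cauchy ?C x"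
        unfolding form_Cauchy_def
      proof (intro allI impI)
        fix e :: real assume e: "0 < e"
        then obtain N where N: "\<And>n. n \<ge> N \<Longrightarrow> the (?C (x n - w)) < e / 4"
          using order_tendstoD(2)[OF core, of "e / 4"] unfolding eventually_sequentially by auto
        have "the (?C (x m - x n)) < e" if "m \<ge> N" "n \<ge> N" for m n
        proof -
          have m: "x m - w \<in> dom ?C" and n: "w - x n \<in> dom ?C"
            using csubspace_diff[OF relaxation_csubspace] xC w by blast+
          show ?thesis
            using form_add_le[OF pC m n] N[OF that(1)] N[OF that(2)]
              form_minus_commute[OF pC w xC, of n] by simp
        qed
        then show "\<exists>N. \<forall>m\<ge>N. \<forall>n\<ge>N. the (?C (x m - x n)) < e" by blast
      qed
      then have "form_Cauchy C' x" by (rule form_Cauchy_mono) (simp add: eq[OF dQ])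
      then have wC': "w \<in> dom C'" and lim: "(\<lambda>n. the (C' (x n - w))) \<longlonglongrightarrow> 0"
        using closed_formD[OF C' dC'[OF xd(1)] xd(2)] by blast+
      have "(\<lambda>n. the (?C (x n))) \<longlonglongrightarrow> the (C' w)"
        using form_tendsto[OF pC' dC'[OF xd(1)] wC' lim] by (simp add: eq[OF xd(1)])
      moreover have "(\<lambda>n. the (?C (x n))) \<longlonglongrightarrow> the (?C w)"
        by (rule form_tendsto[OF pC xC w core])
      ultimately have "the (C' w) = the (?C w)" by (rule LIMSEQ_unique)
      with w wC' show ?thesis by (metis domIff option.expand)
    qed
    then show ?thesis by (simp add: map_le_def)
  qed
  show "closed_form ?C \<and> ?R \<subseteq>\<^sub>m ?C \<and> (\<forall>C'. closed_form C' \<and> ?R \<subseteq>\<^sub>m C' \<longrightarrow> ?C \<subseteq>\<^sub>m C')"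
    using relaxation_closed RC least by blast
  show "C = ?C" if "closed_form C \<and> ?R \<subseteq>\<^sub>m C \<and>
      (\<forall>C'. closed_form C' \<and> ?R \<subseteq>\<^sub>m C' \<longrightarrow> C \<subseteq>\<^sub>m C')" for C
    using that least relaxation_closed RC map_le_antisym by blast
qed

lemma closure_regular_part_eq_relaxation:
  "closure (dom Q) = UNIV \<Longrightarrow> form_closure (regular_part Q) = relaxation Q"
  by (simp add: regular_part_eq_relaxation form_closure_relaxation_restrict)

end

section \<open>Resolvents and self-adjointness\<close>

lemma form_operator_iff:
  assumes dense: "closure (dom Q) = UNIV"
  shows "form_operator Q u = Some f \<longleftrightarrow> u \<in> dom Q \<and> (\<forall>v\<in>dom Q. sesq Q u v = cinner f v)"
proof -
  have unique: "f = g" if "\<forall>v\<in>dom Q. sesq Q u v = cinner f v" "\<forall>v\<in>dom Q. sesq Q u v = cinner g v" for f g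
    by (rule cinner_eq_on_dense[OF dense]) (use that in simp)
  have the_g: "(THE f. \<forall>v\<in>dom Q. sesq Q u v = cinner f v) = f"
    if "\<forall>v\<in>dom Q. sesq Q u v = cinner f v" for f
    by (rule the_equality[where P = "\<lambda>f. \<forall>v\<in>dom Q. sesq Q u v = cinner f v"])
      (use that unique in blast)+
  show ?thesis
  proof (intro iffI)
    assume some: "form_operator Q u = Some f"
    have def: "u \<in> dom Q \<and> (\<exists>f. \<forall>v\<in>dom Q. sesq Q u v = cinner f v)"
    proof (rule ccontr)
      assume "\<not> ?thesis"
      from if_not_P[OF this] have "form_operator Q u = None" unfolding form_operator_def .
      with some show False by simp
    qed
    have f: "(THE f. \<forall>v\<in>dom Q. sesq Q u v = cinner f v) = f"
      using some unfolding form_operator_def if_P[OF def] option.inject .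
    from def obtain g where u: "u \<in> dom Q" and g: "\<forall>v\<in>dom Q. sesq Q u v = cinner g v" by blast
    show "u \<in> dom Q \<and> (\<forall>v\<in>dom Q. sesq Q u v = cinner f v)"
      using u g the_g[OF g] f by simp
  next
    assume f: "u \<in> dom Q \<and> (\<forall>v\<in>dom Q. sesq Q u v = cinner f v)"
    then have def: "u \<in> dom Q \<and> (\<exists>f. \<forall>v\<in>dom Q. sesq Q u v = cinner f v)" by blast
    show "form_operator Q u = Some f"
      unfolding form_operator_def if_P[OF def] option.inject by (rule the_g[OF conjunct2[OF f]])
  qed
qed

text \<open>The functional whose minimiser is \<open>(H + 1)\<^sup>-\<^sup>1 f\<close>, for \<open>H\<close> the operator of \<open>Q\<close>.\<close>

definition resolvent_energy :: "('a::chilbert_space \<rightharpoonup> real) \<Rightarrow> 'a \<Rightarrow> 'a \<Rightarrow> real" where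
  "resolvent_energy Q f v = the (Q v) + (norm v)\<^sup>2 - 2 * inner f v"

text \<open>The expansion of the functional at its critical point has no linear term. It shows that the excess over the minimum controls
  the squared distance to the minimiser.\<close>

lemma resolvent_energy_expand:
  assumes pf: "positive_form Q" and r: "r \<in> dom Q" and v: "v \<in> dom Q"
    and eq: "\<forall>w\<in>dom Q. sesq Q r w + cinner r w = cinner f w"
  shows "resolvent_energy Q f v = resolvent_energy Q f r + the (Q (v - r)) + (norm (v - r))\<^sup>2"
proof -
  have d: "v - r \<in> dom Q" using csubspace_diff[OF form_csubspace[OF pf] v r] .
  have "Re (sesq Q r (v - r)) + inner r (v - r) = inner f (v - r)"
    using eq d by (metis inner_Re_cinner plus_complex.sel(1))
  moreover have "the (Q v) = the (Q r) + the (Q (v - r)) + 2 * Re (sesq Q r (v - r))"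
    using form_add[OF pf r d] by simp
  moreover have "(norm v)\<^sup>2 = (norm r)\<^sup>2 + (norm (v - r))\<^sup>2 + 2 * inner r (v - r)"
    by (simp add: power2_norm_eq_inner inner_diff_left inner_diff_right inner_commute[of v r])
  ultimately show ?thesis
    unfolding resolvent_energy_def by (simp add: inner_diff_right)
qed

lemma resolvent_oneI:
  assumes H: "positive_selfadjoint H" and u: "H u = Some g"
  shows "resolvent_one H (g + u) = u"
  unfolding resolvent_one_def
proof (rule the_equality)
  show "\<exists>g'. H u = Some g' \<and> g' + u = g + u" using u by blast
  fix v assume "\<exists>g'. H v = Some g' \<and> g' + v = g + u"
  then obtain g' where v: "H v = Some g'" and eq: "g' + v = g + u" by blast
  have lin: "csubspace (dom H)"
      "\<And>x y. x \<in> dom H \<Longrightarrow> y \<in> dom H \<Longrightarrow> the (H (x + y)) = the (H x) + the (H y)"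
    using H by (auto simp: positive_selfadjoint_def linear_op_def)
  have ud: "u \<in> dom H" and vd: "v \<in> dom H" using u v by blast+
  have d: "v - u \<in> dom H" using csubspace_diff[OF lin(1) vd ud] .
  have "the (H (v - u)) = g' - g" using lin(2)[OF d ud] u v by simp
  also have "\<dots> = u - v" using eq by (simp add: algebra_simps)
  finally have "Re (cinner (the (H (v - u))) (v - u)) = - (norm (v - u))\<^sup>2"
    by (simp add: power2_norm_eq_inner inner_diff_left inner_diff_right flip: inner_Re_cinner)
  moreover have "0 \<le> Re (cinner (the (H (v - u))) (v - u))"
    using H d by (simp add: positive_selfadjoint_def)
  ultimately show "v = u" by simp
qed

lemma op_adjoint_eqI:
  assumes dense: "closure (dom H) = UNIV" and "\<forall>v\<in>dom H. cinner (the (H v)) u = cinner v f"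
  shows "op_adjoint H u = Some f"
proof -
  have unique: "g = f" if "\<forall>v\<in>dom H. cinner (the (H v)) u = cinner v g" for g
    by (rule cinner_eq_on_dense[OF dense])
      (use that assms(2) cinner_commute in metis)
  have "(THE f. \<forall>v\<in>dom H. cinner (the (H v)) u = cinner v f) = f"
    by (rule the_equality[where P = "\<lambda>f. \<forall>v\<in>dom H. cinner (the (H v)) u = cinner v f"])
      (use assms(2) unique in blast)+
  then show ?thesis unfolding op_adjoint_def using assms(2) by auto
qed

lemma op_adjointD:
  assumes dense: "closure (dom H) = UNIV" and u: "op_adjoint H u = Some f" and v: "v \<in> dom H"
  shows "cinner (the (H v)) u = cinner v f"
proof -
  obtain g where g: "\<forall>v\<in>dom H. cinner (the (H v)) u = cinner v g"
    using u by (auto simp: op_adjoint_def split: if_splits)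
  then have "g = f" using op_adjoint_eqI[OF dense g] u by simp
  with g v show ?thesis by simp
qed

text \<open>Taking adjoints reverses inclusion, so \<open>K = K\<^sup>* \<subseteq> H\<^sup>* = H\<close>.\<close>

lemma selfadjoint_no_extension:
  assumes H: "positive_selfadjoint H" and K: "positive_selfadjoint K" and sub: "H \<subseteq>\<^sub>m K"
  shows "H = K"
proof (rule map_le_antisym[OF sub])
  have dH: "closure (dom H) = UNIV" and dK: "closure (dom K) = UNIV"
    and aH: "op_adjoint H = H" and aK: "op_adjoint K = K"
    using H K by (auto simp: positive_selfadjoint_def)
  have "H u = K u" if u: "u \<in> dom K" for u
  proof -
    obtain f where f: "K u = Some f" using u by blast
    then have Kf: "op_adjoint K u = Some f" by (simp add: aK)
    have "\<forall>v\<in>dom H. cinner (the (H v)) u = cinner v f"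
    proof
      fix v assume v: "v \<in> dom H"
      then have "H v = K v" and "v \<in> dom K"
        using sub map_le_implies_dom_le[OF sub] by (auto simp: map_le_def)
      then show "cinner (the (H v)) u = cinner v f" using op_adjointD[OF dK Kf] by simp
    qed
    from op_adjoint_eqI[OF dH this] show ?thesis by (simp add: aH f)
  qed
  then show "K \<subseteq>\<^sub>m H" by (simp add: map_le_def)
qed

text \<open>If \<open>H u = g\<close>, then \<open>u\<close> is the resolvent of \<open>H\<close>, hence of \<open>K\<close>, at \<open>g + u\<close>. As \<open>K + 1\<close> is onto, this forces
  \<open>K u = g\<close>, so \<open>K\<close> extends \<open>H\<close>.\<close>

lemma resolvent_one_determines:
  assumes H: "positive_selfadjoint H" and K: "positive_selfadjoint K"
    and onto: "\<And>f. \<exists>u g. K u = Some g \<and> g + u = f"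
    and eq: "\<And>f. resolvent_one H f = resolvent_one K f"
  shows "H = K"
proof (rule selfadjoint_no_extension[OF H K])
  have "H u = K u" if u: "u \<in> dom H" for u
  proof -
    obtain g where g: "H u = Some g" using u by blast
    obtain u' g' where K': "K u' = Some g'" "g' + u' = g + u" using onto by blast
    have "u' = u" using resolvent_oneI[OF H g] resolvent_oneI[OF K K'(1)] eq K'(2) by simp
    then show ?thesis using g K' by simp
  qed
  then show "H \<subseteq>\<^sub>m K" by (simp add: map_le_def)
qed

section \<open>The operator of a closed form\<close>

context
  fixes Q :: "'a::chilbert_space \<rightharpoonup> real"
  assumes cf: "closed_form Q" and dense: "closure (dom Q) = UNIV"
begin

lemmas closed_pos = closed_form_positive[OF cf]

lemma form_operator_resolvent:
  assumes l: "0 < l"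
  obtains v g where "form_operator Q v = Some g" "g + l *\<^sub>R v = f"
proof -
  obtain v where v: "v \<in> dom Q"
    and eq: "\<forall>w\<in>dom Q. sesq Q v w + complex_of_real l * cinner v w = cinner f w"
    using form_resolvent_exists[OF cf l] by blast
  have "sesq Q v w = cinner (f - l *\<^sub>R v) w" if "w \<in> dom Q" for w
    using bspec[OF eq that]
    by (simp add: cinner_diff_left scaleR_scaleC cinner_scaleC_left algebra_simps)
  then have "form_operator Q v = Some (f - l *\<^sub>R v)"
    using v by (simp add: form_operator_iff[OF dense])
  then show thesis by (rule that) simp
qed

lemma form_operator_onto: "\<exists>u g. form_operator Q u = Some g \<and> g + u = f"
  by (rule form_operator_resolvent[of 1 f]) auto

text \<open>The approximants are \<open>x\<^sub>n = n (H + n)\<^sup>-\<^sup>1 u\<close> for \<open>n \<ge> 1\<close>. With \<open>d = u - x\<^sub>n\<close> the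
  resolvent equation reads \<open>H x\<^sub>n = n d\<close>, whence
  \<open>Q[u] = Q[x\<^sub>n] + Q[d] + 2 n \<parallel>d\<parallel>\<^sup>2\<close>: the energy does not increase and \<open>d\<close> tends to zero.\<close>

lemma form_operator_core:
  assumes u: "u \<in> dom Q"
  obtains x where "\<And>n. x n \<in> dom (form_operator Q)" "x \<longlonglongrightarrow> u"
    "\<And>n. the (Q (x n)) \<le> the (Q u)"
proof -
  have "\<exists>v g. form_operator Q v = Some g \<and> g + real (Suc n) *\<^sub>R v = real (Suc n) *\<^sub>R u" for n
    by (rule form_operator_resolvent[of "real (Suc n)" "real (Suc n) *\<^sub>R u"]) auto
  then obtain x g where x: "\<And>n. form_operator Q (x n) = Some (g n)"
    and g: "\<And>n. g n + real (Suc n) *\<^sub>R x n = real (Suc n) *\<^sub>R u" by metis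
  have bounds: "the (Q (x n)) \<le> the (Q u) \<and> (norm (x n - u))\<^sup>2 \<le> the (Q u) / real (Suc n)" for n
  proof -
    let ?d = "u - x n"
    have xQ: "x n \<in> dom Q" and eq: "\<forall>w\<in>dom Q. sesq Q (x n) w = cinner (g n) w"
      using x[of n] by (simp_all add: form_operator_iff[OF dense])
    have d: "?d \<in> dom Q" using csubspace_diff[OF form_csubspace[OF closed_pos] u xQ] .
    have "g n = real (Suc n) *\<^sub>R ?d"
      using g[of n] by (simp only: scaleR_right_diff_distrib eq_diff_eq)
    then have "Re (sesq Q (x n) ?d) = real (Suc n) * (norm ?d)\<^sup>2"
      using bspec[OF eq d] by (simp add: power2_norm_eq_inner flip: inner_Re_cinner)
    then have Qu: "the (Q u) = the (Q (x n)) + the (Q ?d) + 2 * (real (Suc n) * (norm ?d)\<^sup>2)"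
      using form_add[OF closed_pos xQ d] by simp
    have nn: "0 \<le> the (Q (x n))" "0 \<le> the (Q ?d)" "0 \<le> real (Suc n) * (norm ?d)\<^sup>2"
      using form_nonneg[OF closed_pos] xQ d by simp_all
    then have "real (Suc n) * (norm ?d)\<^sup>2 \<le> the (Q u)" using Qu by linarith
    then have "(norm ?d)\<^sup>2 \<le> the (Q u) / real (Suc n)"
      by (simp add: pos_le_divide_eq mult.commute)
    moreover have "the (Q (x n)) \<le> the (Q u)" using Qu nn by linarith
    ultimately show ?thesis by (simp add: norm_minus_commute)
  qed
  have "(\<lambda>n. sqrt (the (Q u) / real (Suc n))) \<longlonglongrightarrow> sqrt 0"
    by (intro tendsto_real_sqrt inverse_Suc_tendsto_zero)
  then have sq: "(\<lambda>n. sqrt (the (Q u) / real (Suc n))) \<longlonglongrightarrow> 0" by simp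
  have "norm (x n - u) \<le> sqrt (the (Q u) / real (Suc n))" for n
    by (rule real_le_rsqrt) (use bounds in blast)
  then have "(\<lambda>n. x n - u) \<longlonglongrightarrow> 0"
    by (intro Lim_null_comparison[OF always_eventually sq]) blast
  then have "x \<longlonglongrightarrow> u" by (rule LIM_zero_cancel)
  moreover have "x n \<in> dom (form_operator Q)" for n using x by blast
  ultimately show thesis by (intro that[OF _ _ conjunct1[OF bounds]])
qed

lemma form_operator_dense: "closure (dom (form_operator Q)) = UNIV"
proof -
  have "dom Q \<subseteq> closure (dom (form_operator Q))"
  proof
    fix u assume u: "u \<in> dom Q"
    obtain x where "\<And>n. x n \<in> dom (form_operator Q)" "x \<longlonglongrightarrow> u"
      using form_operator_core[OF u] by metis
    then show "u \<in> closure (dom (form_operator Q))" unfolding closure_sequential by blast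
  qed
  then have "closure (dom Q) \<subseteq> closure (dom (form_operator Q))"
    by (rule closure_minimal) simp
  then show ?thesis using dense by blast
qed

lemma form_operatorD:
  assumes "u \<in> dom (form_operator Q)"
  shows "u \<in> dom Q" and "v \<in> dom Q \<Longrightarrow> sesq Q u v = cinner (the (form_operator Q u)) v"
proof -
  obtain g where g: "form_operator Q u = Some g" using assms by blast
  then have "u \<in> dom Q \<and> (\<forall>v\<in>dom Q. sesq Q u v = cinner g v)"
    by (rule iffD1[OF form_operator_iff[OF dense]])
  then have "u \<in> dom Q \<and> (\<forall>v\<in>dom Q. sesq Q u v = cinner (the (form_operator Q u)) v)"
    unfolding g option.sel .
  then show "u \<in> dom Q" and "v \<in> dom Q \<Longrightarrow> sesq Q u v = cinner (the (form_operator Q u)) v"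
    by blast+
qed

lemma form_operator_linear: "linear_op (form_operator Q)"
proof -
  let ?H = "form_operator Q"
  note sub = form_csubspace[OF closed_pos]
  have add: "?H (u + v) = Some (the (?H u) + the (?H v))" if u: "u \<in> dom ?H" and v: "v \<in> dom ?H" for u v
    unfolding form_operator_iff[OF dense]
    using form_operatorD[OF u] form_operatorD[OF v]
    by (simp add: csubspace_add[OF sub] sesq_add_left[OF closed_pos] cinner_add_left)
  have scl: "?H (c *\<^sub>C u) = Some (c *\<^sub>C the (?H u))" if u: "u \<in> dom ?H" for c u
    unfolding form_operator_iff[OF dense]
    using form_operatorD[OF u]
    by (simp add: csubspace_scaleC[OF sub] sesq_scaleC_left[OF closed_pos] cinner_scaleC_left)
  obtain u where u: "u \<in> dom ?H" using form_operator_onto by blast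
  have "u + v \<in> dom ?H" if "u \<in> dom ?H" "v \<in> dom ?H" for u v using add[OF that] by blast
  moreover have scl_dom: "c *\<^sub>C u \<in> dom ?H" if "u \<in> dom ?H" for c u using scl[OF that] by blast
  moreover have "0 \<in> dom ?H" using scl_dom[OF u, of 0] by (simp only: scaleC_zero)
  ultimately have "csubspace (dom ?H)" unfolding csubspace_def by blast
  then show ?thesis
    unfolding linear_op_def using add scl by simp
qed

text \<open>Symmetry is that of the form, and surjectivity of \<open>H + 1\<close> makes a symmetric operator self-adjoint: if
  \<open>f\<close> is the value of the adjoint at \<open>u\<close>, then the solution \<open>z\<close> of \<open>H z + z = f + u\<close> has the
  same scalar product with every \<open>H v + v\<close> as \<open>u\<close>.\<close>

lemma form_operator_positive_selfadjoint: "positive_selfadjoint (form_operator Q)"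
  unfolding positive_selfadjoint_def
proof (intro conjI ballI form_operator_linear form_operator_dense)
  let ?H = "form_operator Q"
  show "0 \<le> Re (cinner (the (?H u)) u)" if u: "u \<in> dom ?H" for u
    using form_operatorD[OF u] form_nonneg[OF closed_pos, of u] sesq_self[OF closed_pos, of u] by simp
  have symm: "cinner (the (?H v)) u = cinner v (the (?H u))" if u: "u \<in> dom ?H" and v: "v \<in> dom ?H" for u v
    using form_operatorD[OF u] form_operatorD[OF v] sesq_commute[OF closed_pos, of u v]
    by (metis cinner_commute)
  show "op_adjoint ?H = ?H"
  proof
    fix u
    show "op_adjoint ?H u = ?H u"
    proof (cases "op_adjoint ?H u")
      case None
      have "u \<notin> dom ?H"
        using op_adjoint_eqI[OF form_operator_dense, of u "the (?H u)"] symm None by auto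
      then show ?thesis using None by (simp add: domIff)
    next
      case (Some f)
      obtain z g where z: "?H z = Some g" and g: "g + z = f + u" using form_operator_onto by blast
      have zd: "z \<in> dom ?H" using z by blast
      have "u - z = 0"
      proof (rule orthogonal_to_dense[of UNIV])
        show "\<forall>h\<in>UNIV. cinner (u - z) h = 0"
        proof
          fix h
          obtain v k where v: "?H v = Some k" and h: "k + v = h" using form_operator_onto by blast
          have vd: "v \<in> dom ?H" using v by blast
          have "cinner h u = cinner v (f + u)"
            using op_adjointD[OF form_operator_dense Some vd] v
            by (simp add: h[symmetric] cinner_add_left cinner_add_right)
          also have "\<dots> = cinner h z"
            using symm[OF zd vd] z v
            by (simp add: h[symmetric] g[symmetric] cinner_add_left cinner_add_right)
          finally have "cinner h (u - z) = 0" by (simp add: cinner_diff_right)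
          then show "cinner (u - z) h = 0" by (subst cinner_commute) simp
        qed
      qed simp
      then have "z = u" by simp
      then show ?thesis using z g Some by simp
    qed
  qed
qed

lemma resolvent_one_form_operator:
  shows "resolvent_one (form_operator Q) f \<in> dom Q"
    and "\<forall>w\<in>dom Q. sesq Q (resolvent_one (form_operator Q) f) w
      + cinner (resolvent_one (form_operator Q) f) w = cinner f w"
proof -
  obtain u g where u: "form_operator Q u = Some g" and g: "g + u = f"
    using form_operator_onto by blast
  have "resolvent_one (form_operator Q) f = u"
    using resolvent_oneI[OF form_operator_positive_selfadjoint u] by (simp add: g)
  then show "resolvent_one (form_operator Q) f \<in> dom Q"
    and "\<forall>w\<in>dom Q. sesq Q (resolvent_one (form_operator Q) f) w
      + cinner (resolvent_one (form_operator Q) f) w = cinner f w"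
    using u by (simp_all add: form_operator_iff[OF dense] g[symmetric] cinner_add_left)
qed

end

text \<open>Both forms are given by the operator on its domain. The approximants of \<open>form_operator_core\<close> therefore have
  \<open>R\<close>-energy at most \<open>Q[u]\<close>, and lower semicontinuity of \<open>R\<close> passes this bound to \<open>u\<close>.\<close>

lemma form_operator_eq_imp_le:
  assumes Q: "closed_form Q" "closure (dom Q) = UNIV" and R: "closed_form R" "closure (dom R) = UNIV"
    and eq: "form_operator Q = form_operator R" and u: "u \<in> dom Q"
  shows "u \<in> dom R" and "the (R u) \<le> the (Q u)"
proof -
  obtain x where x: "\<And>n. x n \<in> dom (form_operator Q)" and xu: "x \<longlonglongrightarrow> u"
    and le: "\<And>n. the (Q (x n)) \<le> the (Q u)"
    using form_operator_core[OF Q u] by metis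
  have "(x n, the (Q u)) \<in> form_epigraph R" for n
  proof -
    have xR: "x n \<in> dom (form_operator R)" using x by (simp add: eq)
    have "complex_of_real (the (Q (x n))) = complex_of_real (the (R (x n)))"
      using form_operatorD[OF Q x] form_operatorD[OF R xR]
        sesq_self[OF closed_form_positive[OF Q(1)], of "x n"]
        sesq_self[OF closed_form_positive[OF R(1)], of "x n"] by (simp add: eq)
    then show ?thesis
      using le[of n] form_operatorD(1)[OF R xR] by (simp add: form_epigraph_def)
  qed
  then have "(u, the (Q u)) \<in> form_epigraph R"
    by (intro closed_sequentially[OF closed_form_epigraph_closed[OF R(1)] _
          tendsto_Pair[OF xu tendsto_const]]) blast
  then show "u \<in> dom R" and "the (R u) \<le> the (Q u)" by (simp_all add: form_epigraph_def)
qed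

lemma form_operator_inject:
  assumes Q: "closed_form Q" "closure (dom Q) = UNIV" and R: "closed_form R" "closure (dom R) = UNIV"
    and eq: "form_operator Q = form_operator R"
  shows "Q = R"
proof
  fix u
  note QR = form_operator_eq_imp_le[OF Q R eq] and RQ = form_operator_eq_imp_le[OF R Q eq[symmetric]]
  show "Q u = R u"
  proof (cases "u \<in> dom Q")
    case True
    then have "u \<in> dom R" "the (Q u) = the (R u)" using QR[of u] RQ[of u] by auto
    with True show ?thesis by (metis domIff option.expand)
  next
    case False
    then show ?thesis using RQ(1) by (metis domIff)
  qed
qed

section \<open>Resolvent convergence from above\<close>

text \<open>Let \<open>r\<close> and \<open>s\<^sub>l\<close> be the resolvents of the relaxation \<open>C\<close> and of \<open>q\<^sub>l\<close> at \<open>f\<close>. Since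
  \<open>C \<le> q\<^sub>0 \<le> q\<^sub>l\<close>, the squared distance of \<open>s\<^sub>l\<close> and \<open>r\<close> is at most the difference of the minimal values of the
  two functionals, and the minimal value for \<open>q\<^sub>l\<close> is at most the value at any test vector in the
  common domain. Test vectors recovering \<open>r\<close> make the difference small, first uniformly up to
  \<open>q\<^sub>0\<close>, then by letting \<open>l\<close> tend to zero.\<close>

lemma resolvent_convergence_from_above:
  fixes q :: "real \<Rightarrow> ('a::chilbert_space \<rightharpoonup> real)"
  assumes pf0: "positive_form q0" and dense: "closure (dom q0) = UNIV"
    and closed: "\<And>l. 0 < l \<Longrightarrow> closed_form (q l)"
    and dom_q: "\<And>l. 0 < l \<Longrightarrow> dom (q l) = dom q0"
    and ge: "\<And>l u. 0 < l \<Longrightarrow> u \<in> dom q0 \<Longrightarrow> the (q0 u) \<le> the (q l u)"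
    and lim: "\<And>u. u \<in> dom q0 \<Longrightarrow> ((\<lambda>l. the (q l u)) \<longlongrightarrow> the (q0 u)) (at_right 0)"
  shows "((\<lambda>l. resolvent_one (form_operator (q l)) f)
      \<longlongrightarrow> resolvent_one (form_operator (relaxation q0)) f) (at_right 0)"
proof -
  let ?C = "relaxation q0"
  note cC = relaxation_closed[OF pf0] and pC = relaxation_positive[OF pf0]
  have sub: "dom q0 \<subseteq> dom ?C" using relaxation_le_form(1)[OF pf0] by blast
  have dC: "closure (dom ?C) = UNIV" using closure_mono[OF sub] dense by blast
  define r where "r = resolvent_one (form_operator ?C) f"
  define s where "s l = resolvent_one (form_operator (q l)) f" for l
  have r: "r \<in> dom ?C" and r_eq: "\<forall>w\<in>dom ?C. sesq ?C r w + cinner r w = cinner f w"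
    unfolding r_def by (rule resolvent_one_form_operator[OF cC dC])+
  have compare: "(norm (s l - r))\<^sup>2 \<le> resolvent_energy (q l) f v - resolvent_energy ?C f r"
    if l: "0 < l" and v: "v \<in> dom q0" for l v
  proof -
    have dl: "closure (dom (q l)) = UNIV" using dense dom_q[OF l] by simp
    note pl = closed_form_positive[OF closed[OF l]]
    have sl: "s l \<in> dom (q l)" and sl_eq: "\<forall>w\<in>dom (q l). sesq (q l) (s l) w + cinner (s l) w = cinner f w"
      unfolding s_def by (rule resolvent_one_form_operator[OF closed[OF l] dl])+
    have s0: "s l \<in> dom q0" and sC: "s l \<in> dom ?C" and vl: "v \<in> dom (q l)"
      using sl sub v by (auto simp only: dom_q[OF l])
    have "resolvent_energy ?C f r + (norm (s l - r))\<^sup>2 \<le> resolvent_energy ?C f (s l)"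
      using resolvent_energy_expand[OF pC r sC r_eq]
        form_nonneg[OF pC csubspace_diff[OF form_csubspace[OF pC] sC r]] by linarith
    also have "\<dots> \<le> resolvent_energy (q l) f (s l)"
      using relaxation_le_form(2)[OF pf0 s0] ge[OF l s0] by (simp add: resolvent_energy_def)
    also have "\<dots> \<le> resolvent_energy (q l) f v"
      using resolvent_energy_expand[OF pl sl vl sl_eq]
        form_nonneg[OF pl csubspace_diff[OF form_csubspace[OF pl] vl sl]]
        zero_le_power2[of "norm (v - s l)"] by linarith
    finally show ?thesis by simp
  qed
  obtain x where x: "recovers q0 x r" using recovers_exists[OF pf0 r] .
  note xd = recoversD[OF pf0 x]
  have xe: "(\<lambda>n. resolvent_energy q0 f (x n)) \<longlonglongrightarrow> resolvent_energy ?C f r"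
    unfolding resolvent_energy_def
    by (intro tendsto_diff tendsto_add tendsto_mult tendsto_const tendsto_inner tendsto_power
        tendsto_norm xd(2,3))
  have "(s \<longlongrightarrow> r) (at_right 0)"
  proof (rule tendstoI)
    fix e :: real assume e: "0 < e"
    then have e2: "0 < e\<^sup>2" by simp
    have "\<forall>\<^sub>F n in sequentially. resolvent_energy q0 f (x n) < resolvent_energy ?C f r + e\<^sup>2 / 2"
      by (rule order_tendstoD(2)[OF xe]) (use e2 in simp)
    then obtain n where n: "resolvent_energy q0 f (x n) < resolvent_energy ?C f r + e\<^sup>2 / 2"
      using eventually_happens'[OF sequentially_bot] by blast
    have "\<forall>\<^sub>F l in at_right 0. the (q l (x n)) < the (q0 (x n)) + e\<^sup>2 / 2"
      by (rule order_tendstoD(2)[OF lim[OF xd(1)]]) (use e2 in simp)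
    moreover have "\<forall>\<^sub>F l in at_right 0. (0::real) < l" by (rule eventually_at_right_less)
    ultimately show "\<forall>\<^sub>F l in at_right 0. dist (s l) r < e"
    proof eventually_elim
      case (elim l)
      have "(norm (s l - r))\<^sup>2 < e\<^sup>2"
        using compare[OF elim(2) xd(1), of n] elim(1) n unfolding resolvent_energy_def by argo
      then show ?case using e by (simp add: dist_norm power2_less_imp_less)
    qed
  qed
  then show ?thesis by (simp only: s_def[abs_def] r_def)
qed

text \<open>Resolvents determine the limit operator, and the operator determines the form, so a candidate with the right
  resolvent limit is the trace.\<close>

lemma trace_form_eqI:
  assumes cf: "closed_form C" and dense: "closure (dom C) = UNIV"
    and lim: "\<And>f. ((\<lambda>l. resolvent_one (form_operator (approx_trace_form E J l)) f)
      \<longlongrightarrow> resolvent_one (form_operator C) f) (at_right 0)"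
  shows "trace_form E J = C"
proof -
  note psa = form_operator_positive_selfadjoint[OF cf dense]
  have op: "trace_operator E J = form_operator C"
    unfolding trace_operator_def
  proof (rule the_equality)
    show "positive_selfadjoint (form_operator C) \<and>
        (\<forall>f. ((\<lambda>l. resolvent_one (form_operator (approx_trace_form E J l)) f)
          \<longlongrightarrow> resolvent_one (form_operator C) f) (at_right 0))"
      using psa lim by blast
    fix H assume H: "positive_selfadjoint H \<and>
        (\<forall>f. ((\<lambda>l. resolvent_one (form_operator (approx_trace_form E J l)) f)
          \<longlongrightarrow> resolvent_one H f) (at_right 0))"
    have "resolvent_one H f = resolvent_one (form_operator C) f" for f
      using tendsto_unique[OF trivial_limit_at_right_real] H lim by blast
    then show "H = form_operator C"
      using resolvent_one_determines[OF _ psa form_operator_onto[OF cf dense]] H by blast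
  qed
  show ?thesis
    unfolding trace_form_def op
    by (rule the_equality) (use cf dense form_operator_inject in blast)+
qed

section \<open>Weakly bounded sets\<close>

text \<open>The uniform boundedness principle. By Baire's theorem one of the closed sets of functionals bounded by \<open>m\<close> on
  \<open>S\<close> contains a ball of radius \<open>e\<close> around some \<open>f\<close>; moving from \<open>f\<close> by \<open>e\<close> in the direction
  of \<open>v\<close> measures the norm of \<open>v\<close>.\<close>

lemma weakly_bounded_imp_bounded:
  fixes S :: "'a::{real_inner,complete_space} set"
  assumes "\<And>f. \<exists>M. \<forall>v\<in>S. \<bar>inner f v\<bar> \<le> M"
  shows "\<exists>M>0. \<forall>v\<in>S. norm v \<le> M"
proof -
  define A where "A m = {f. \<forall>v\<in>S. \<bar>inner f v\<bar> \<le> real m}" for m :: nat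
  have closed_A: "closed (A m)" for m
  proof -
    have "A m = (\<Inter>v\<in>S. {f. \<bar>inner f v\<bar> \<le> real m})" by (auto simp: A_def)
    then show ?thesis by (auto intro!: closed_INT closed_Collect_le continuous_intros)
  qed
  have cover: "\<Union>(range A) = UNIV"
  proof -
    have "\<exists>m. f \<in> A m" for f
    proof -
      obtain M where M: "\<forall>v\<in>S. \<bar>inner f v\<bar> \<le> M" using assms by blast
      obtain m :: nat where "M \<le> real m" using real_arch_simple by blast
      with M have "f \<in> A m" unfolding A_def by fastforce
      then show ?thesis by blast
    qed
    then show ?thesis by blast
  qed
  have "\<exists>m. interior (A m) \<noteq> {}"
  proof (rule ccontr)
    assume "\<not> ?thesis"
    then have "euclidean interior_of \<Union>(range A) = {}"
      using closed_A by (intro Baire_category_alt)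
        (auto simp: completely_metrizable_space_euclidean)
    then show False by (simp add: cover)
  qed
  then obtain m f where "f \<in> interior (A m)" by blast
  then obtain e where e: "0 < e" "cball f e \<subseteq> A m" using mem_interior_cball by blast
  have "norm v \<le> 2 * real m / e" if v: "v \<in> S" for v
  proof (cases "v = 0")
    case False
    define g where "g = (e / norm v) *\<^sub>R v"
    have "f \<in> A m" "f + g \<in> A m"
      using e False by (auto simp: g_def dist_norm)
    then have "\<bar>inner f v\<bar> \<le> real m" "\<bar>inner (f + g) v\<bar> \<le> real m" using v by (auto simp: A_def)
    then have "inner g v \<le> 2 * real m" by (simp add: inner_add_left)
    moreover have "inner g v = e * norm v"
      using False by (simp add: g_def power2_norm_eq_inner[symmetric] power2_eq_square)
    ultimately show ?thesis using e(1) by (simp add: field_simps)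
  qed (use e in simp)
  then have "\<forall>v\<in>S. norm v \<le> 2 * real m / e + 1" by fastforce
  moreover have "0 < 2 * real m / e + 1" using e(1) by (simp add: add_nonneg_pos)
  ultimately show ?thesis by blast
qed

section \<open>Minimal lifts from the range of a boundary map\<close>

text \<open>The element of the fibre of \<open>J\<close> over \<open>w\<close> that is \<open>E\<^sub>l\<close>-orthogonal to the kernel. For \<open>l > 0\<close>
  it is \<open>P\<^sub>l u\<close> for every \<open>u\<close> in the fibre; for \<open>l = 0\<close> it is the harmonic element. Treating both
  at once makes the forms directly comparable.\<close>

definition lift :: "('a::chilbert_space \<rightharpoonup> real) \<Rightarrow> ('a \<rightharpoonup> 'b::chilbert_space) \<Rightarrow> real \<Rightarrow> 'b \<Rightarrow> 'a" where
  "lift E J l w = (THE h. J h = Some w \<and> (\<forall>v\<in>op_kernel J. sesq (shift_form l E) h v = 0))"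

definition lift_form ::
    "('a::chilbert_space \<rightharpoonup> real) \<Rightarrow> ('a \<rightharpoonup> 'b::chilbert_space) \<Rightarrow> real \<Rightarrow> ('b \<rightharpoonup> real)" where
  "lift_form E J l w = (if w \<in> ran J then Some (the (shift_form l E (lift E J l w))) else None)"

locale boundary_map =
  fixes E :: "'a::chilbert_space \<rightharpoonup> real" and J :: "'a \<rightharpoonup> 'b::chilbert_space"
  assumes E_closed: "closed_form E" and J_linear: "linear_op J" and J_sub: "dom J \<subseteq> dom E"
    and J_closed: "form_closed_op E J"
begin

lemmas E_pos = closed_form_positive[OF E_closed]

lemma J_csubspace: "csubspace (dom J)"
  using J_linear by (simp add: linear_op_def)

lemma J_add: assumes u: "J u = Some x" and v: "J v = Some y" shows "J (u + v) = Some (x + y)"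
proof -
  have ud: "u \<in> dom J" and vd: "v \<in> dom J" using u v by blast+
  have "the (J (u + v)) = the (J u) + the (J v)"
    using J_linear ud vd unfolding linear_op_def by blast
  moreover obtain z where "J (u + v) = Some z" using csubspace_add[OF J_csubspace ud vd] by blast
  ultimately show ?thesis using u v by simp
qed

lemma J_scaleC: assumes u: "J u = Some x" shows "J (c *\<^sub>C u) = Some (c *\<^sub>C x)"
proof -
  have ud: "u \<in> dom J" using u by blast
  have "the (J (c *\<^sub>C u)) = c *\<^sub>C the (J u)"
    using J_linear ud unfolding linear_op_def by blast
  moreover obtain z where "J (c *\<^sub>C u) = Some z" using csubspace_scaleC[OF J_csubspace ud] by blast
  ultimately show ?thesis using u by simp
qed

lemma J_diff: "J u = Some x \<Longrightarrow> J v = Some y \<Longrightarrow> J (u - v) = Some (x - y)"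
  using J_add[of u x "(-1) *\<^sub>C v" "(-1) *\<^sub>C y"] J_scaleC[of v y "-1"]
  by (simp add: scaleC_minus_one)

lemma J_dom_E: "J u = Some x \<Longrightarrow> u \<in> dom E"
  using J_sub by blast

lemma kernel_sub: "op_kernel J \<subseteq> dom E"
  using J_dom_E by (auto simp: op_kernel_def)

lemma kernel_csubspace: "csubspace (op_kernel J)"
proof -
  obtain x where x: "J 0 = Some x" using csubspace_zero[OF J_csubspace] by blast
  have "J 0 = Some 0" using J_scaleC[OF x, of 0] by (simp add: scaleC_zero)
  then show ?thesis
    using J_add J_scaleC unfolding csubspace_def op_kernel_def
    by (auto simp: scaleC_zero_right dest: J_add[of _ 0 _ 0] J_scaleC[of _ 0])
qed

lemma diff_kernel_iff:
  assumes u: "J u = Some w" and h: "h \<in> dom J"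
  shows "u - h \<in> op_kernel J \<longleftrightarrow> J h = Some w"
proof -
  obtain x where x: "J h = Some x" using h by blast
  show ?thesis using J_diff[OF u x] x by (auto simp: op_kernel_def)
qed

lemma kernel_form_closed:
  assumes x: "\<And>n. x n \<in> op_kernel J" and xu: "x \<longlonglongrightarrow> u" and u: "u \<in> dom E"
    and lim: "(\<lambda>n. the (E (x n - u))) \<longlonglongrightarrow> 0"
  shows "u \<in> op_kernel J"
proof -
  have Jx: "J (x n) = Some 0" for n using x by (simp add: op_kernel_def)
  have d: "x n - u \<in> dom E" for n
    using csubspace_diff[OF form_csubspace[OF E_pos] J_dom_E[OF Jx] u] .
  have "(\<lambda>n. norm (x n - u)) \<longlonglongrightarrow> 0" using xu by (simp add: tendsto_norm_zero LIM_zero)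
  then have "(\<lambda>n. the (E (x n - u)) + 1 * (norm (x n - u))\<^sup>2) \<longlonglongrightarrow> 0 + 1 * 0\<^sup>2"
    by (intro tendsto_add tendsto_mult tendsto_power tendsto_const lim)
  then have "(\<lambda>n. the (shift_form 1 E (x n - u))) \<longlonglongrightarrow> 0"
    by (simp add: the_shift_form[OF d])
  moreover have "(\<lambda>n. the (J (x n))) \<longlonglongrightarrow> 0" by (simp add: Jx)
  moreover have "\<forall>n. x n \<in> dom J" using Jx by blast
  ultimately have "J u = Some 0" using J_closed u unfolding form_closed_op_def by blast
  then show ?thesis by (simp add: op_kernel_def)
qed

end

text \<open>The constant \<open>c\<close> is \<open>l\<close> itself for \<open>l > 0\<close>, and the spectral gap of the Dirichlet operator for
  \<open>l = 0\<close>.\<close>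

locale coercive_boundary_map = boundary_map E J
  for E :: "'a::chilbert_space \<rightharpoonup> real" and J :: "'a \<rightharpoonup> 'b::chilbert_space" +
  fixes l c :: real
  assumes l: "0 \<le> l" and c: "0 < c"
    and coercive: "v \<in> op_kernel J \<Longrightarrow> c * (norm v)\<^sup>2 \<le> the (shift_form l E v)"
begin

abbreviation El :: "'a \<rightharpoonup> real" where "El \<equiv> shift_form l E"

lemmas El_pos = shift_form_positive(1)[OF E_pos l]

definition is_lift :: "'a \<Rightarrow> 'b \<Rightarrow> bool" where
  "is_lift h w \<longleftrightarrow> J h = Some w \<and> (\<forall>v\<in>op_kernel J. sesq El h v = 0)"

lemma is_lift_dom: "is_lift h w \<Longrightarrow> h \<in> dom El"
  using J_dom_E by (auto simp: is_lift_def)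

lemma kernel_dom: "v \<in> op_kernel J \<Longrightarrow> v \<in> dom El"
  using kernel_sub by auto

lemma is_lift_unique: assumes "is_lift h w" "is_lift h' w" shows "h' = h"
proof -
  have d: "h' - h \<in> op_kernel J"
    using assms J_diff[of h' w h w] by (simp add: is_lift_def op_kernel_def)
  have "sesq El (h' - h) (h' - h) = 0"
    using sesq_diff_left[OF El_pos is_lift_dom[OF assms(2)] is_lift_dom[OF assms(1)] kernel_dom[OF d]]
      assms d by (simp add: is_lift_def)
  then have "the (El (h' - h)) = 0" using sesq_self[OF El_pos kernel_dom[OF d]] by simp
  then have "c * (norm (h' - h))\<^sup>2 \<le> 0" using coercive[OF d] by simp
  then show ?thesis using c by (simp add: mult_le_0_iff)
qed

text \<open>The lift is \<open>u - k\<close>, where \<open>k\<close> is the orthogonal projection of \<open>u\<close> onto the kernel. Projecting onto the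
  kernel, rather than onto its complement, needs completeness of the kernel only.\<close>

lemma is_lift_exists:
  assumes u: "J u = Some w"
  shows "\<exists>h. is_lift h w"
proof -
  have uE: "u \<in> dom El" using J_dom_E[OF u] by simp
  have "\<exists>k\<in>op_kernel J. \<forall>v\<in>op_kernel J. sesq El k v = sesq El u v"
  proof (rule form_variational[OF El_pos kernel_csubspace])
    show "op_kernel J \<subseteq> dom El" using kernel_dom by blast
    show "form_complete_on El (op_kernel J)"
      by (rule closed_form_complete_on[OF E_closed l c kernel_csubspace kernel_sub coercive])
        (use kernel_form_closed in blast)+
    show "sesq El u (v + v') = sesq El u v + sesq El u v'"
      if "v \<in> op_kernel J" "v' \<in> op_kernel J" for v v'
      by (rule sesq_add_right[OF El_pos kernel_dom[OF that(1)] kernel_dom[OF that(2)] uE])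
    show "sesq El u (a *\<^sub>C v) = cnj a * sesq El u v" if "v \<in> op_kernel J" for a v
      by (rule sesq_scaleC_right[OF El_pos uE kernel_dom[OF that]])
    show "- the (El u) \<le> the (El v) - 2 * Re (sesq El u v)" if v: "v \<in> op_kernel J" for v
      using form_diff[OF El_pos uE kernel_dom[OF v]]
        form_nonneg[OF El_pos csubspace_diff[OF form_csubspace[OF El_pos] uE kernel_dom[OF v]]]
      by simp
  qed
  then obtain k where k: "k \<in> op_kernel J"
    and eq: "\<And>v. v \<in> op_kernel J \<Longrightarrow> sesq El k v = sesq El u v" by blast
  have "is_lift (u - k) w"
    using J_diff[OF u, of k 0] k eq sesq_diff_left[OF El_pos uE kernel_dom[OF k] kernel_dom]
    by (simp add: is_lift_def op_kernel_def)
  then show ?thesis by blast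
qed

lemma lift_eqI: "is_lift h w \<Longrightarrow> lift E J l w = h"
  unfolding lift_def is_lift_def[symmetric] by (rule the_equality) (use is_lift_unique in blast)+

lemma is_lift_lift: "w \<in> ran J \<Longrightarrow> is_lift (lift E J l w) w"
  using is_lift_exists lift_eqI unfolding ran_def by fastforce

lemma is_lift_add:
  assumes "is_lift g x" "is_lift h y" shows "is_lift (g + h) (x + y)"
  using assms J_add sesq_add_left[OF El_pos is_lift_dom[OF assms(1)] is_lift_dom[OF assms(2)] kernel_dom]
  by (simp add: is_lift_def)

lemma is_lift_scaleC: assumes "is_lift h x" shows "is_lift (a *\<^sub>C h) (a *\<^sub>C x)"
  using assms J_scaleC sesq_scaleC_left[OF El_pos is_lift_dom[OF assms] kernel_dom]
  by (simp add: is_lift_def)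

lemma ran_csubspace: "csubspace (ran J)"
proof -
  have "0 \<in> ran J"
    using csubspace_zero[OF kernel_csubspace] by (auto simp: op_kernel_def ran_def)
  moreover have "x + y \<in> ran J" if "x \<in> ran J" "y \<in> ran J" for x y
    using that J_add unfolding ran_def by blast
  moreover have "a *\<^sub>C x \<in> ran J" if "x \<in> ran J" for a x
    using that J_scaleC unfolding ran_def by blast
  ultimately show ?thesis by (simp add: csubspace_def)
qed

lemma lift_add:
  "x \<in> ran J \<Longrightarrow> y \<in> ran J \<Longrightarrow> lift E J l (x + y) = lift E J l x + lift E J l y"
  by (intro lift_eqI is_lift_add is_lift_lift)

lemma lift_scaleC: "x \<in> ran J \<Longrightarrow> lift E J l (a *\<^sub>C x) = a *\<^sub>C lift E J l x"
  by (intro lift_eqI is_lift_scaleC is_lift_lift)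

lemma lift_diff:
  assumes "x \<in> ran J" "y \<in> ran J" shows "lift E J l (x - y) = lift E J l x - lift E J l y"
  using lift_add[OF csubspace_diff[OF ran_csubspace assms] assms(2)] by simp

lemma lift_dom: "w \<in> ran J \<Longrightarrow> lift E J l w \<in> dom El"
  using is_lift_dom[OF is_lift_lift] .

lemma lift_boundary: "w \<in> ran J \<Longrightarrow> J (lift E J l w) = Some w"
  using is_lift_lift by (auto simp: is_lift_def)

lemma dom_lift_form: "dom (lift_form E J l) = ran J"
  by (auto simp: lift_form_def split: if_splits)

lemma the_lift_form: "w \<in> ran J \<Longrightarrow> the (lift_form E J l w) = the (El (lift E J l w))"
  by (simp add: lift_form_def)

lemma lift_form_positive: "positive_form (lift_form E J l)"
proof (rule positive_formI[of _ "\<lambda>x y. sesq El (lift E J l x) (lift E J l y)"], unfold dom_lift_form)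
  show "sesquilinear_on (ran J) (\<lambda>x y. sesq El (lift E J l x) (lift E J l y))"
    unfolding sesquilinear_on_def
    by (intro conjI allI ballI)
      (simp_all only: lift_add lift_scaleC lift_dom sesq_add_left[OF El_pos]
        sesq_add_right[OF El_pos] sesq_scaleC_left[OF El_pos] sesq_scaleC_right[OF El_pos])
qed (simp_all only: ran_csubspace the_lift_form sesq_self[OF El_pos] form_nonneg[OF El_pos] lift_dom)

text \<open>Pythagoras: \<open>u\<close> is the orthogonal sum of the lift of its boundary value and an element of the kernel.\<close>

lemma lift_form_minimal:
  assumes u: "J u = Some w" shows "the (lift_form E J l w) \<le> the (El u)"
proof -
  have w: "w \<in> ran J" using u by (auto simp: ran_def)
  let ?h = "lift E J l w"
  have k: "u - ?h \<in> op_kernel J" using J_diff[OF u lift_boundary[OF w]] by (simp add: op_kernel_def)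
  have "sesq El ?h (u - ?h) = 0" using is_lift_lift[OF w] k by (simp add: is_lift_def)
  then have "the (El u) = the (El ?h) + the (El (u - ?h))"
    using form_add[OF El_pos lift_dom[OF w] kernel_dom[OF k]] by simp
  then show ?thesis using form_nonneg[OF El_pos kernel_dom[OF k]] by (simp add: the_lift_form[OF w])
qed

text \<open>Lifts of a Cauchy sequence form an \<open>E\<^sub>l\<close>-Cauchy sequence. Since \<open>l > 0\<close>, its limit \<open>u\<close> exists
  in \<open>dom E\<close>; closedness of \<open>J\<close> gives \<open>J u = w\<close>, and orthogonality to the kernel is preserved, so
  \<open>u\<close> is the lift of \<open>w\<close>.\<close>

lemma lift_form_closed:
  assumes l_pos: "0 < l"
  shows "closed_form (lift_form E J l)"
  unfolding closed_form_def form_Cauchy_def[symmetric] dom_lift_form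
proof (intro conjI[OF lift_form_positive] allI impI, elim conjE)
  let ?L = "lift E J l"
  fix x w assume x': "\<forall>n. x n \<in> ran J" and xw: "x \<longlonglongrightarrow> w" and Cx: "form_Cauchy (lift_form E J l) x"
  have x: "x n \<in> ran J" for n using x' by blast
  have "form_Cauchy El (\<lambda>n. ?L (x n))"
    by (rule form_Cauchy_mono[OF Cx])
      (simp add: the_lift_form csubspace_diff[OF ran_csubspace] lift_diff x)
  moreover have "form_complete_on El (dom E)"
    by (rule closed_form_complete_on[OF E_closed l l_pos form_csubspace[OF E_pos]])
      (simp_all add: the_shift_form form_nonneg[OF E_pos])
  ultimately obtain u where u: "u \<in> dom E" and lim: "(\<lambda>n. the (El (?L (x n) - u))) \<longlonglongrightarrow> 0"
    unfolding form_complete_on_def using lift_dom[OF x] by (metis dom_shift_form)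
  have uEl: "u \<in> dom El" using u by simp
  have d: "?L (x n) - u \<in> dom E" for n
    using csubspace_diff[OF form_csubspace[OF E_pos] _ u] lift_dom[OF x] by simp
  have "(\<lambda>n. (1 + 1 / l) * the (El (?L (x n) - u))) \<longlonglongrightarrow> (1 + 1 / l) * 0"
    by (intro tendsto_mult tendsto_const lim)
  then have lim': "(\<lambda>n. (1 + 1 / l) * the (El (?L (x n) - u))) \<longlonglongrightarrow> 0" by simp
  \<comment> \<open>Closedness of \<open>J\<close> refers to \<open>E\<^sub>1\<close>, which is bounded by \<open>(1 + 1 / l) E\<^sub>l\<close>.\<close>
  have bound: "norm (the (shift_form 1 E (?L (x n) - u))) \<le> (1 + 1 / l) * the (El (?L (x n) - u))" for n
  proof -
    have "(1 + 1 / l) * the (El (?L (x n) - u)) = the (shift_form 1 E (?L (x n) - u))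
        + (the (E (?L (x n) - u)) / l + l * (norm (?L (x n) - u))\<^sup>2)"
      using l_pos by (simp add: the_shift_form[OF d] field_simps)
    moreover have "0 \<le> the (E (?L (x n) - u)) / l + l * (norm (?L (x n) - u))\<^sup>2"
      using form_nonneg[OF E_pos d] l_pos by simp
    moreover have "0 \<le> the (shift_form 1 E (?L (x n) - u))"
      using form_nonneg[OF E_pos d] by (simp add: the_shift_form[OF d])
    ultimately show ?thesis by simp
  qed
  have lim1: "(\<lambda>n. the (shift_form 1 E (?L (x n) - u))) \<longlonglongrightarrow> 0"
    by (rule Lim_null_comparison[OF always_eventually[OF allI[OF bound]] lim'])
  have Jx: "(\<lambda>n. the (J (?L (x n)))) \<longlonglongrightarrow> w" using xw by (simp add: lift_boundary[OF x])
  have "\<forall>n. ?L (x n) \<in> dom J" using lift_boundary[OF x] by blast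
  then have Ju: "J u = Some w"
    using J_closed[unfolded form_closed_op_def, rule_format, of "\<lambda>n. ?L (x n)" u w] u lim1 Jx
    by blast
  have "sesq El u v = 0" if v: "v \<in> op_kernel J" for v
  proof -
    have "(\<lambda>n. sesq El (?L (x n)) v) \<longlonglongrightarrow> sesq El u v"
      by (rule sesq_tendsto_left[OF El_pos lift_dom[OF x] uEl kernel_dom[OF v] lim])
    moreover have "sesq El (?L (x n)) v = 0" for n
      using is_lift_lift[OF x] v by (simp add: is_lift_def)
    ultimately show ?thesis by (simp add: LIMSEQ_const_iff)
  qed
  with Ju have "is_lift u w" by (simp add: is_lift_def)
  then have Lw: "?L w = u" by (rule lift_eqI)
  have w: "w \<in> ran J" using Ju by (auto simp: ran_def)
  have "the (lift_form E J l (x n - w)) = the (El (?L (x n) - u))" for n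
    by (simp add: the_lift_form csubspace_diff[OF ran_csubspace] x w lift_diff Lw)
  with lim w show "w \<in> ran J \<and> (\<lambda>n. the (lift_form E J l (x n - w))) \<longlonglongrightarrow> 0" by simp
qed

lemma form_on_range_lift:
  assumes "\<And>u w. J u = Some w \<Longrightarrow> f u = the (El (lift E J l w))"
  shows "form_on_range J f = lift_form E J l"
proof
  fix w
  show "form_on_range J f w = lift_form E J l w"
  proof (cases "w \<in> ran J")
    case True
    have "(THE r. \<forall>u. J u = Some w \<longrightarrow> f u = r) = the (El (lift E J l w))"
      by (rule the_equality) (use assms lift_boundary[OF True] in blast)+
    then show ?thesis using True by (simp add: form_on_range_def lift_form_def)
  qed (simp add: form_on_range_def lift_form_def)
qed

text \<open>The lift \<open>h\<close> of \<open>J u\<close> lies in the orthogonal complement of the kernel and differs from \<open>u\<close> by an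
  element of the kernel, so it is the projection of \<open>u\<close>.\<close>

lemma approx_trace_form_eq_lift_form:
  assumes l_pos: "0 < l"
  shows "approx_trace_form E J l = lift_form E J l"
  unfolding approx_trace_form_def
proof (rule form_on_range_lift)
  fix u w assume u: "J u = Some w"
  let ?M = "form_orth El (op_kernel J)"
  have w: "w \<in> ran J" using u by (auto simp: ran_def)
  let ?h = "lift E J l w"
  have hM: "?h \<in> ?M" using is_lift_lift[OF w] lift_dom[OF w] by (simp add: form_orth_def is_lift_def)
  have uE: "u \<in> dom El" using J_dom_E[OF u] by simp
  have k: "u - ?h \<in> op_kernel J" using J_diff[OF u lift_boundary[OF w]] by (simp add: op_kernel_def)
  have MD: "v \<in> dom El" if "v \<in> ?M" for v using that by (simp add: form_orth_def)
  have h_orth: "sesq El (u - ?h) v = 0" if v: "v \<in> ?M" for v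
    using sesq_commute[OF El_pos MD[OF v] kernel_dom[OF k]] v k by (simp add: form_orth_def)
  have "form_proj El ?M u = ?h"
    unfolding form_proj_def
  proof (rule the_equality)
    show "?h \<in> ?M \<and> (\<forall>v\<in>?M. sesq El (u - ?h) v = 0)" using hM h_orth by blast
    fix g assume g: "g \<in> ?M \<and> (\<forall>v\<in>?M. sesq El (u - g) v = 0)"
    have d: "g - ?h \<in> dom El"
      using csubspace_diff[OF form_csubspace[OF El_pos]] MD g hM by blast
    have dM: "g - ?h \<in> ?M"
      using g hM sesq_diff_left[OF El_pos MD MD kernel_dom] d by (simp add: form_orth_def)
    have ug: "u - g \<in> dom El" and uh: "u - ?h \<in> dom El"
      using csubspace_diff[OF form_csubspace[OF El_pos] uE] MD g hM by blast+
    have "g - ?h = (u - ?h) - (u - g)" by simp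
    then have "sesq El (g - ?h) (g - ?h) = 0"
      using sesq_diff_left[OF El_pos uh ug d] g h_orth[OF dM] dM by (metis diff_zero)
    then have "the (El (g - ?h)) = 0" using sesq_self[OF El_pos d] by simp
    then have "the (E (g - ?h)) + l * (norm (g - ?h))\<^sup>2 = 0" using d by (simp add: the_shift_form)
    moreover have "0 \<le> the (E (g - ?h))" using form_nonneg[OF E_pos] d by simp
    moreover have "0 \<le> l * (norm (g - ?h))\<^sup>2" using l by simp
    ultimately have "l * (norm (g - ?h))\<^sup>2 = 0" by linarith
    then show "g = ?h" using l_pos by simp
  qed
  then show "the (El (trace_proj E J l u)) = the (El ?h)" by (simp add: trace_proj_def)
qed

end

section \<open>The harmonic form and the trace\<close>

text \<open>The two descriptions are conditions on the same element: \<open>u - h\<close> is in the kernel precisely when \<open>h\<close> has the boundary value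
  of \<open>u\<close>.\<close>

lemma (in boundary_map) harmonic_proj_eq_lift:
  assumes u: "J u = Some w" shows "harmonic_proj E J u = lift E J 0 w"
proof -
  have "(h \<in> harmonic E J \<and> u - h \<in> op_kernel J)
      \<longleftrightarrow> (J h = Some w \<and> (\<forall>v\<in>op_kernel J. sesq E h v = 0))" for h
    using diff_kernel_iff[OF u, of h] by (auto simp: harmonic_def)
  then show ?thesis by (simp add: harmonic_proj_def lift_def shift_form_zero)
qed

text \<open>For each \<open>f\<close> there is \<open>w\<close> in the kernel with \<open>\<langle>f, v\<rangle> = E(w, v)\<close>, so
  \<open>\<bar>\<langle>f, v\<rangle>\<bar>\<^sup>2 \<le> E[w]\<close> on the \<open>E\<close>-unit ball of the kernel. This ball is thus weakly bounded, hence bounded by some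
  \<open>M\<close>, which is the gap \<open>1 / M\<^sup>2\<close>.\<close>

lemma (in boundary_map) dirichlet_gap:
  assumes dense: "closure (op_kernel J) = UNIV"
    and onto: "ran (form_operator (dirichlet_form E J)) = UNIV"
  shows "\<exists>c>0. \<forall>v\<in>op_kernel J. c * (norm v)\<^sup>2 \<le> the (E v)"
proof -
  let ?D = "dirichlet_form E J"
  have dom_D: "dom ?D = op_kernel J" using kernel_sub by (auto simp: dirichlet_form_def)
  have sesq_D: "sesq ?D u v = sesq E u v" if "u \<in> op_kernel J" "v \<in> op_kernel J" for u v
    using csubspace_add[OF kernel_csubspace that(1) csubspace_scaleC[OF kernel_csubspace that(2)]]
    by (simp add: sesq_def dirichlet_form_def)
  define S where "S = {v \<in> op_kernel J. the (E v) \<le> 1}"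
  have "\<exists>M. \<forall>v\<in>S. \<bar>inner f v\<bar> \<le> M" for f
  proof -
    obtain w where "form_operator ?D w = Some f" using onto unfolding ran_def by blast
    then have w: "w \<in> op_kernel J" and eq: "\<forall>v\<in>op_kernel J. sesq ?D w v = cinner f v"
      using form_operator_iff[of ?D w f] dense by (simp_all add: dom_D)
    have "\<bar>inner f v\<bar> \<le> sqrt (the (E w))" if v: "v \<in> S" for v
    proof (rule real_le_rsqrt)
      have vk: "v \<in> op_kernel J" and vE: "v \<in> dom E" and wE: "w \<in> dom E" and v1: "the (E v) \<le> 1"
        using v w kernel_sub by (auto simp: S_def)
      have "\<bar>inner f v\<bar> \<le> cmod (sesq E w v)"
        using bspec[OF eq vk] sesq_D[OF w vk] by (simp add: inner_Re_cinner abs_Re_le_cmod)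
      then have "\<bar>inner f v\<bar>\<^sup>2 \<le> (cmod (sesq E w v))\<^sup>2" by (rule power_mono) simp
      also have "\<dots> \<le> the (E w) * the (E v)" by (rule form_Cauchy_Schwarz[OF E_pos wE vE])
      also have "\<dots> \<le> the (E w) * 1" by (intro mult_left_mono v1 form_nonneg[OF E_pos wE])
      finally show "\<bar>inner f v\<bar>\<^sup>2 \<le> the (E w)" by simp
    qed
    then show ?thesis by blast
  qed
  then obtain M where M: "0 < M" and SM: "\<And>v. v \<in> S \<Longrightarrow> norm v \<le> M"
    using weakly_bounded_imp_bounded[of S] by blast
  have "(norm v)\<^sup>2 \<le> M\<^sup>2 * the (E v)" if v: "v \<in> op_kernel J" for v
  proof (rule field_le_epsilon)
    fix e :: real assume e: "0 < e"
    have vE: "v \<in> dom E" using v kernel_sub by blast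
    note nn = form_nonneg[OF E_pos vE]
    \<comment> \<open>The summand with \<open>e\<close> permits the normalisation of \<open>v\<close> even if \<open>E[v] = 0\<close>.\<close>
    define a where "a = the (E v) + e / M\<^sup>2"
    have a: "0 < a" "the (E v) \<le> a" using e M nn by (simp_all add: a_def add_nonneg_pos)
    have "the (E ((1 / sqrt a) *\<^sub>R v)) = the (E v) / a"
      using a by (simp add: form_scaleR[OF E_pos vE] power_divide)
    then have "(1 / sqrt a) *\<^sub>R v \<in> S"
      using a v by (simp add: S_def csubspace_scaleR[OF kernel_csubspace])
    from SM[OF this] have "norm v \<le> M * sqrt a" using a by (simp add: field_simps)
    then have "(norm v)\<^sup>2 \<le> (M * sqrt a)\<^sup>2" by (simp add: power_mono)
    also have "\<dots> = M\<^sup>2 * the (E v) + e" using a M by (simp add: power_mult_distrib a_def field_simps)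
    finally show "(norm v)\<^sup>2 \<le> M\<^sup>2 * the (E v) + e" .
  qed
  then have "\<forall>v\<in>op_kernel J. (1 / M\<^sup>2) * (norm v)\<^sup>2 \<le> the (E v)"
    using M by (simp add: field_simps)
  then show ?thesis using M by (intro exI[of _ "1 / M\<^sup>2"]) simp
qed

theorem proposition3p6:
  fixes E :: "'a::chilbert_space \<rightharpoonup> real"
    and J :: "'a \<rightharpoonup> 'b::chilbert_space"
  assumes "closed_form E"
    and "linear_op J"
    and "dom J \<subseteq> dom E"
    and "closure (ran J) = UNIV"
    and "form_closed_op E J"
    and "closure (op_kernel J) = UNIV"
    and "harmonic E J \<inter> op_kernel J = {0}"
    and "ran (form_operator (dirichlet_form E J)) = UNIV"
  shows "trace_form E J = form_closure (regular_part (harmonic_form E J))"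
proof -
  interpret boundary_map E J by unfold_locales (fact assms)+
  obtain c where c: "0 < c" and gap: "\<And>v. v \<in> op_kernel J \<Longrightarrow> c * (norm v)\<^sup>2 \<le> the (E v)"
    using dirichlet_gap[OF assms(6,8)] by blast
  interpret har: coercive_boundary_map E J 0 c
    by unfold_locales (use c gap in \<open>simp_all add: shift_form_zero\<close>)
  have approx: "coercive_boundary_map E J l l" if "0 < l" for l
  proof unfold_locales
    show "l * (norm v)\<^sup>2 \<le> the (shift_form l E v)" if v: "v \<in> op_kernel J" for v
    proof -
      have "v \<in> dom E" using v kernel_sub by blast
      then show ?thesis by (simp add: the_shift_form form_nonneg[OF E_pos])
    qed
  qed (use that in simp_all)
  let ?q = "lift_form E J"
  have dom_q: "dom (?q l) = ran J" if "0 < l" for l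
    by (rule coercive_boundary_map.dom_lift_form[OF approx[OF that]])
  have har_eq: "harmonic_form E J = ?q 0"
    unfolding harmonic_form_def
    by (rule har.form_on_range_lift) (simp add: harmonic_proj_eq_lift shift_form_zero)
  \<comment> \<open>The lift for \<open>l\<close> competes in the minimisation that defines \<open>q\<^sub>0[w]\<close>.\<close>
  have lower: "the (?q 0 w) \<le> the (?q l w)" if l: "0 < l" and w: "w \<in> ran J" for l w
  proof -
    interpret l: coercive_boundary_map E J l l by (rule approx[OF l])
    have h: "lift E J l w \<in> dom E" using l.lift_dom[OF w] by simp
    have "the (?q 0 w) \<le> the (E (lift E J l w))"
      using har.lift_form_minimal[OF l.lift_boundary[OF w]] by (simp add: shift_form_zero)
    also have "\<dots> \<le> the (?q l w)"
      using l by (simp add: l.the_lift_form[OF w] the_shift_form[OF h])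
    finally show ?thesis .
  qed
  \<comment> \<open>The harmonic lift competes in the minimisation that defines \<open>q\<^sub>l[w]\<close>.\<close>
  have upper: "the (?q l w) \<le> the (?q 0 w) + l * (norm (lift E J 0 w))\<^sup>2" if l: "0 < l" and w: "w \<in> ran J" for l w
  proof -
    interpret l: coercive_boundary_map E J l l by (rule approx[OF l])
    have h: "lift E J 0 w \<in> dom E" using har.lift_dom[OF w] by simp
    show ?thesis
      using l.lift_form_minimal[OF har.lift_boundary[OF w]]
      by (simp add: the_shift_form[OF h] har.the_lift_form[OF w] shift_form_zero)
  qed
  have pointwise: "((\<lambda>l. the (?q l w)) \<longlongrightarrow> the (?q 0 w)) (at_right 0)" if w: "w \<in> ran J" for w
  proof (rule tendsto_sandwich)
    have pos: "\<forall>\<^sub>F l in at_right 0. (0::real) < l" by (rule eventually_at_right_less)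
    show "\<forall>\<^sub>F l in at_right 0. the (?q 0 w) \<le> the (?q l w)"
      using pos by eventually_elim (rule lower[OF _ w])
    show "\<forall>\<^sub>F l in at_right 0. the (?q l w) \<le> the (?q 0 w) + l * (norm (lift E J 0 w))\<^sup>2"
      using pos by eventually_elim (rule upper[OF _ w])
    have "((\<lambda>l. the (?q 0 w) + l * (norm (lift E J 0 w))\<^sup>2)
        \<longlongrightarrow> the (?q 0 w) + 0 * (norm (lift E J 0 w))\<^sup>2) (at_right 0)"
      by (intro tendsto_add tendsto_mult tendsto_const tendsto_ident_at)
    then show "((\<lambda>l. the (?q 0 w) + l * (norm (lift E J 0 w))\<^sup>2) \<longlongrightarrow> the (?q 0 w)) (at_right 0)"
      by simp
  qed simp
  have dense: "closure (dom (?q 0)) = UNIV" by (simp add: har.dom_lift_form assms(4))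
  have conv: "((\<lambda>l. resolvent_one (form_operator (approx_trace_form E J l)) f)
      \<longlongrightarrow> resolvent_one (form_operator (relaxation (?q 0))) f) (at_right 0)" for f
  proof (rule Lim_transform_eventually)
    show "((\<lambda>l. resolvent_one (form_operator (?q l)) f)
        \<longlongrightarrow> resolvent_one (form_operator (relaxation (?q 0))) f) (at_right 0)"
    proof (rule resolvent_convergence_from_above[OF har.lift_form_positive dense])
      show "closed_form (?q l)" if "0 < l" for l
        by (rule coercive_boundary_map.lift_form_closed[OF approx[OF that] that])
    qed (simp_all add: har.dom_lift_form dom_q lower pointwise)
    have "\<forall>\<^sub>F l in at_right 0. (0::real) < l" by (rule eventually_at_right_less)
    then show "\<forall>\<^sub>F l in at_right 0. resolvent_one (form_operator (?q l)) f
        = resolvent_one (form_operator (approx_trace_form E J l)) f"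
      by eventually_elim (simp add: coercive_boundary_map.approx_trace_form_eq_lift_form[OF approx])
  qed
  have sub: "dom (?q 0) \<subseteq> dom (relaxation (?q 0))"
    using relaxation_le_form(1)[OF har.lift_form_positive] by blast
  have "trace_form E J = relaxation (?q 0)"
    by (rule trace_form_eqI[OF relaxation_closed[OF har.lift_form_positive] _ conv])
      (use closure_mono[OF sub] dense in blast)
  also have "\<dots> = form_closure (regular_part (harmonic_form E J))"
    using closure_regular_part_eq_relaxation[OF har.lift_form_positive dense] by (simp add: har_eq)
  finally show ?thesis .
qed

end
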